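(* Let $K$ be a field and let $G$ be a very well-covered finite simple graph without isolated vertices such that $I(G)^{[k]}$ is Cohen-Macaulay for all $1\le k\le\nu(G)$. Then $$g_{I(G)}(k)=\frac{|V(G)|}{2}-k\quad\text{for all } 1\le k\le\nu(G).$$
   Context: $S$ is the polynomial ring over $K$ whose variables are the vertices of $G$, and $I(G)\subset S$ is the edge ideal of $G$, generated by the products $xy$ with $\{x,y\}\in E(G)$. $G$ is unmixed (well-covered) if all minimal vertex covers of $G$ have the same size; $G$ is very well-covered if it is unmixed and $\mathrm{height}\, I(G)=|V(G)|/2$. A matching of $G$ is a set of pairwise disjoint edges; $\nu(G)$ is the maximum size of a matching. For a squarefree monomial ideal $I\subset S$ with minimal monomial generating set $\mathcal{G}(I)$, the $k$th matching power $I^{[k]}$ is the ideal generated by all products $u_1\cdots u_k$ with $u_1,\dots,u_k\in\mathcal{G}(I)$ having pairwise disjoint supports, and $\nu(I)=\max\{k: I^{[k]}\neq 0\}$; one has $\nu(I(G))=\nu(G)$. An ideal $I\subset S$ is called Cohen-Macaulay if $S/I$ is a Cohen-Macaulay ring. The normalized depth function $g_I$ of a squarefree monomial ideal $I\subset S$ is defined by $g_I(k)=\mathrm{depth}\, S/I^{[k]}-(\alpha(I^{[k]})-1)$ for $1\le k\le\nu(I)$, where $\alpha(I^{[k]})$ is the initial degree of $I^{[k]}$, i.e. the smallest degree of a nonzero homogeneous element of $I^{[k]}$. *)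

theory Defs
  imports
    "HOL-Algebra.Ring_Divisibility"
    "HOL-Library.Poly_Mapping"
    "HOL-Library.Extended_Nat"
    "HOL-Library.Disjoint_Sets"
    Complex_Main
begin

section \<open>Finite simple graphs\<close>

text \<open>A graph is given by its vertex set and its set of edges, the latter being
  two-element sets of vertices.\<close>

definition simple_graph :: "'v set \<Rightarrow> 'v set set \<Rightarrow> bool" where
  "simple_graph V E \<longleftrightarrow> finite V \<and> (\<forall>e\<in>E. e \<subseteq> V \<and> card e = 2)"

definition no_isolated_vertices :: "'v set \<Rightarrow> 'v set set \<Rightarrow> bool" where
  "no_isolated_vertices V E \<longleftrightarrow> (\<forall>v\<in>V. \<exists>e\<in>E. v \<in> e)"

definition vertex_cover :: "'v set \<Rightarrow> 'v set set \<Rightarrow> 'v set \<Rightarrow> bool" where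
  "vertex_cover V E C \<longleftrightarrow> C \<subseteq> V \<and> (\<forall>e\<in>E. e \<inter> C \<noteq> {})"

definition minimal_vertex_cover :: "'v set \<Rightarrow> 'v set set \<Rightarrow> 'v set \<Rightarrow> bool" where
  "minimal_vertex_cover V E C \<longleftrightarrow>
     vertex_cover V E C \<and> (\<forall>D. D \<subset> C \<longrightarrow> \<not> vertex_cover V E D)"

definition unmixed :: "'v set \<Rightarrow> 'v set set \<Rightarrow> bool" where
  "unmixed V E \<longleftrightarrow>
     (\<forall>C D. minimal_vertex_cover V E C \<and> minimal_vertex_cover V E D \<longrightarrow> card C = card D)"

definition matching :: "'v set set \<Rightarrow> 'v set set \<Rightarrow> bool" where
  "matching E M \<longleftrightarrow> M \<subseteq> E \<and> disjoint M"

definition matching_number :: "'v set set \<Rightarrow> nat" where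
  "matching_number E = Max (card ` {M. matching E M})"


section \<open>Height, depth and Cohen-Macaulay rings\<close>

definition prime_height :: "('a, 'b) ring_scheme \<Rightarrow> 'a set \<Rightarrow> enat" where
  "prime_height R P =
     Sup {enat n | n. \<exists>c :: nat \<Rightarrow> 'a set.
       (\<forall>i\<le>n. primeideal (c i) R) \<and> (\<forall>i<n. c i \<subset> c (Suc i)) \<and> c n = P}"

definition ideal_height :: "('a, 'b) ring_scheme \<Rightarrow> 'a set \<Rightarrow> enat" where
  "ideal_height R I = Inf {prime_height R P | P. primeideal P R \<and> I \<subseteq> P}"

text \<open>The second conjunct says that \<open>xs ! i\<close> is a non-zero-divisor on the quotient of \<open>R\<close> by
  the ideal generated by \<open>xs ! 0, \<dots>, xs ! (i - 1)\<close>.\<close>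

definition regular_sequence :: "('a, 'b) ring_scheme \<Rightarrow> 'a list \<Rightarrow> bool" where
  "regular_sequence R xs \<longleftrightarrow>
     set xs \<subseteq> carrier R \<and>
     (\<forall>i<length xs. \<forall>a\<in>carrier R.
        xs ! i \<otimes>\<^bsub>R\<^esub> a \<in> Idl\<^bsub>R\<^esub> (set (take i xs)) \<longrightarrow> a \<in> Idl\<^bsub>R\<^esub> (set (take i xs))) \<and>
     Idl\<^bsub>R\<^esub> (set xs) \<noteq> carrier R"

definition ideal_depth :: "('a, 'b) ring_scheme \<Rightarrow> 'a set \<Rightarrow> enat" where
  "ideal_depth R P = Sup {enat (length xs) | xs. regular_sequence R xs \<and> set xs \<subseteq> P}"

text \<open>Eisenbud, Commutative Algebra, Section 18.2: a Noetherian ring is Cohen-Macaulay if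
  depth equals codimension for each of its maximal ideals. This agrees with the definition by
  localizations at maximal ideals.\<close>

definition cohen_macaulay_ring :: "('a, 'b) ring_scheme \<Rightarrow> bool" where
  "cohen_macaulay_ring R \<longleftrightarrow>
     cring R \<and> noetherian_ring R \<and>
     (\<forall>P. maximalideal P R \<longrightarrow> ideal_depth R P = prime_height R P)"


section \<open>Polynomial rings\<close>

text \<open>Exponent vectors are finitely supported functions from variables to natural numbers;
  polynomials are finitely supported functions from exponent vectors to the field.\<close>

type_synonym 'v expo = "'v \<Rightarrow>\<^sub>0 nat"
type_synonym ('v, 'k) mpoly = "'v expo \<Rightarrow>\<^sub>0 'k"

definition poly_ring :: "'v set \<Rightarrow> ('v, 'k::field) mpoly ring" where
  "poly_ring V =
     \<lparr>carrier = {p. \<forall>m\<in>Poly_Mapping.keys p. Poly_Mapping.keys m \<subseteq> V},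
      mult = (*), one = 1, zero = 0, add = (+)\<rparr>"

definition mon :: "'v expo \<Rightarrow> ('v, 'k::field) mpoly" where
  "mon m = Poly_Mapping.single m 1"

definition var :: "'v \<Rightarrow> ('v, 'k::field) mpoly" where
  "var v = mon (Poly_Mapping.single v 1)"

definition homogeneous :: "nat \<Rightarrow> ('v, 'k::field) mpoly \<Rightarrow> bool" where
  "homogeneous d p \<longleftrightarrow>
     (\<forall>m\<in>Poly_Mapping.keys p. (\<Sum>v\<in>Poly_Mapping.keys m. Poly_Mapping.lookup m v) = d)"

definition initial_degree :: "('v, 'k::field) mpoly set \<Rightarrow> nat" where
  "initial_degree I = (LEAST d. \<exists>p\<in>I. p \<noteq> 0 \<and> homogeneous d p)"

definition graded_maximal_ideal :: "'v set \<Rightarrow> ('v, 'k::field) mpoly set" where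
  "graded_maximal_ideal V = Idl\<^bsub>poly_ring V\<^esub> (var ` V)"

text \<open>The depth of the graded ring \<open>S/I\<close> is taken with respect to the image of the graded
  maximal ideal of \<open>S\<close>.\<close>

definition quotient_depth :: "'v set \<Rightarrow> ('v, 'k::field) mpoly set \<Rightarrow> enat" where
  "quotient_depth V I =
     ideal_depth (poly_ring V Quot I)
       ((\<lambda>p. I +>\<^bsub>poly_ring V\<^esub> p) ` graded_maximal_ideal V)"

definition cohen_macaulay_ideal :: "'v set \<Rightarrow> ('v, 'k::field) mpoly set \<Rightarrow> bool" where
  "cohen_macaulay_ideal V I \<longleftrightarrow>
     ideal I (poly_ring V) \<and> cohen_macaulay_ring (poly_ring V Quot I)"


section \<open>Matching powers of monomial ideals\<close>

definition generated_by_monomials ::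
    "'v set \<Rightarrow> ('v, 'k::field) mpoly set \<Rightarrow> 'v expo set \<Rightarrow> bool" where
  "generated_by_monomials V I B \<longleftrightarrow>
     (\<forall>m\<in>B. Poly_Mapping.keys m \<subseteq> V) \<and> I = Idl\<^bsub>poly_ring V\<^esub> (mon ` B)"

text \<open>The exponent vectors of the unique minimal set of monomial generators of a monomial ideal.\<close>

definition min_monomial_gens :: "'v set \<Rightarrow> ('v, 'k::field) mpoly set \<Rightarrow> 'v expo set" where
  "min_monomial_gens V I =
     (THE B. generated_by_monomials V I B \<and>
        (\<forall>B'. B' \<subset> B \<longrightarrow> \<not> generated_by_monomials V I B'))"

definition matching_power ::
    "'v set \<Rightarrow> ('v, 'k::field) mpoly set \<Rightarrow> nat \<Rightarrow> ('v, 'k) mpoly set" where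
  "matching_power V I k =
     Idl\<^bsub>poly_ring V\<^esub>
       {\<Prod>i<k. mon (u i) | u.
          (\<forall>i<k. u i \<in> min_monomial_gens V I) \<and>
          (\<forall>i<k. \<forall>j<k. i \<noteq> j \<longrightarrow> Poly_Mapping.keys (u i) \<inter> Poly_Mapping.keys (u j) = {})}"

text \<open>\<open>the_enat\<close> is harmless here: for a proper ideal \<open>I\<close>, the depth of \<open>S/I\<close> is finite.\<close>

definition normalized_depth :: "'v set \<Rightarrow> ('v, 'k::field) mpoly set \<Rightarrow> nat \<Rightarrow> int" where
  "normalized_depth V I k =
     int (the_enat (quotient_depth V (matching_power V I k)))
       - (int (initial_degree (matching_power V I k)) - 1)"


section \<open>Edge ideals\<close>

text \<open>The first argument only serves to fix the coefficient field.\<close>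

definition edge_ideal :: "'k::field itself \<Rightarrow> 'v set \<Rightarrow> 'v set set \<Rightarrow> ('v, 'k) mpoly set" where
  "edge_ideal K V E = Idl\<^bsub>poly_ring V\<^esub> {var x * var y | x y. {x, y} \<in> E}"

definition very_well_covered :: "'k::field itself \<Rightarrow> 'v set \<Rightarrow> 'v set set \<Rightarrow> bool" where
  "very_well_covered K V E \<longleftrightarrow>
     unmixed V E \<and>
     2 * ideal_height (poly_ring V :: ('v, 'k) mpoly ring) (edge_ideal K V E) = enat (card V)"

end

theory Submission
  imports Defs
begin

text \<open>
  Let \<open>h\<close> be the common size of the minimal vertex covers, so that \<open>card V = 2 * h\<close>. The ideal
  \<open>I(G)^[k]\<close> is generated by the squarefree monomials of the vertex sets of \<open>k\<close>-matchings, so its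
  initial degree is \<open>2 * k\<close> and its minimal primes are generated by the minimal vertex sets \<open>D\<close>
  that meet every \<open>k\<close>-matching. The smallest such \<open>D\<close> has \<open>h - k + 1\<close> elements: fewer do not
  suffice because \<open>G\<close> has a perfect matching, and a vertex cover of size \<open>h\<close> with \<open>k - 1\<close> vertices
  removed does suffice. Cohen-Macaulayness turns the depth of \<open>S/I(G)^[k]\<close> into the height of its
  graded maximal ideal, which is \<open>2 * h - (h - k + 1)\<close>.

  That this height is the number of variables outside \<open>D\<close> is proved without dimension theory: a
  longer chain of primes would give more elements than variables outside \<open>D\<close>, and an algebraic
  relation among these contradicts the strictness of the chain.
\<close>

text \<open>The predicate \<open>very_well_covered\<close> speaks of the height of I(G) and not of
  matchings, so h has to be read off from that height and the perfect matching has to be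
  constructed. The former works because unmixedness makes every minimal cover one of least size. The
  latter is Hall's theorem on the complement of a minimal cover. Hall's condition there says that an
  independent set never has more elements than neighbours, and this is where unmixedness and the
  absence of isolated vertices enter.

  A single bound on the length of prime chains gives both heights that occur: that of I(G), and that
  of the graded maximal ideal modulo I(G)^[k]. The algebraic relation behind it is a linear
  dependency, found by counting equations and unknowns.

  The result is then arithmetic: the depth h + k - 1 minus (2k - 1) is h - k.\<close>

section \<open>Matchings in well-covered graphs\<close>

text \<open>Induction on X. If some nonempty proper subset T is tight, meaning that it has exactly
  \<open>card T\<close> neighbours, then T is matched within its neighbours and X - T outside them.
  Otherwise every nonempty proper subset has a spare neighbour, so any x may take any neighbour
  y.\<close>

lemma hall:
  assumes "finite X" "\<And>x. x \<in> X \<Longrightarrow> finite (N x)"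
    and "\<And>T. T \<subseteq> X \<Longrightarrow> card T \<le> card (\<Union>(N ` T))"
  shows "\<exists>f. inj_on f X \<and> (\<forall>x\<in>X. f x \<in> N x)"
  using assms
proof (induction "card X" arbitrary: X N rule: less_induct)
  case (less X N)
  show ?case
  proof (cases "X = {}")
    case False
    then obtain x where x: "x \<in> X" by blast
    show ?thesis
    proof (cases "\<exists>T. T \<noteq> {} \<and> T \<subset> X \<and> card (\<Union>(N ` T)) = card T")
      case True
      then obtain T where T: "T \<noteq> {}" "T \<subset> X" "card (\<Union>(N ` T)) = card T" by blast
      have finT: "finite T" using T less.prems(1) finite_subset by blast
      have finN: "finite (\<Union>(N ` U))" if "U \<subseteq> X" for U
        using that less.prems(1,2) by (meson finite_UN finite_subset subsetD)
      have "\<exists>f. inj_on f T \<and> (\<forall>x\<in>T. f x \<in> N x)"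
        using T less.prems by (intro less.hyps) (auto intro: psubset_card_mono finT)
      then obtain f where f: "inj_on f T" "\<And>x. x \<in> T \<Longrightarrow> f x \<in> N x" by blast
      define N' where "N' x = N x - \<Union>(N ` T)" for x
      have "\<exists>g. inj_on g (X - T) \<and> (\<forall>x\<in>X - T. g x \<in> N' x)"
      proof (intro less.hyps)
        show "card (X - T) < card X"
          using T less.prems(1) by (intro psubset_card_mono) auto
        fix U assume U: "U \<subseteq> X - T"
        then have finU: "finite U" using less.prems(1) finite_subset by blast
        \<comment> \<open>Hall's condition for U in the reduced system is the condition for the
          union of U and T, minus the tight contribution of T.\<close>
        have "card U + card T = card (U \<union> T)"
          using U finU finT by (subst card_Un_disjoint) auto
        also have "\<dots> \<le> card (\<Union>(N ` (U \<union> T)))"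
          using U T by (intro less.prems(3)) auto
        also have "\<Union>(N ` (U \<union> T)) = \<Union>(N' ` U) \<union> \<Union>(N ` T)"
          unfolding N'_def by auto
        also have "card \<dots> = card (\<Union>(N' ` U)) + card (\<Union>(N ` T))"
          by (intro card_Un_disjoint finite_subset[OF _ finN[of U]] finN)
            (use U T in \<open>auto simp: N'_def\<close>)
        finally show "card U \<le> card (\<Union>(N' ` U))" using T(3) by simp
      qed (use less.prems in \<open>auto simp: N'_def\<close>)
      then obtain g where g: "inj_on g (X - T)" "\<And>x. x \<in> X - T \<Longrightarrow> g x \<in> N' x" by blast
      have "f a \<noteq> g b" if "a \<in> T" "b \<in> X - T" for a b
        using f(2)[OF that(1)] g(2)[OF that(2)] that(1) unfolding N'_def by auto
      then have ne: "f a = g b \<Longrightarrow> False" "g b = f a \<Longrightarrow> False" if "a \<in> T" "b \<in> X - T" for a b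
        using that by (auto simp: eq_commute[of "g b"])
      have "inj_on (\<lambda>x. if x \<in> T then f x else g x) X"
        using f(1) g(1) by (auto intro!: inj_onI dest: inj_onD ne split: if_splits)
      moreover have "\<forall>x\<in>X. (if x \<in> T then f x else g x) \<in> N x"
        using f g unfolding N'_def by auto
      ultimately show ?thesis by (intro exI[of _ "\<lambda>x. if x \<in> T then f x else g x"]) blast
    next
      case False
      have "card {x} \<le> card (\<Union>(N ` {x}))" using x by (intro less.prems) auto
      then obtain y where y: "y \<in> N x" by (cases "N x = {}") auto
      define N' where "N' z = N z - {y}" for z
      have "\<exists>g. inj_on g (X - {x}) \<and> (\<forall>z\<in>X - {x}. g z \<in> N' z)"
      proof (intro less.hyps)
        show "card (X - {x}) < card X"
          using x less.prems(1) by (intro psubset_card_mono) auto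
        fix U assume U: "U \<subseteq> X - {x}"
        show "card U \<le> card (\<Union>(N' ` U))"
        proof (cases "U = {}")
          case neq: False
          have "U \<subset> X" using U x by blast
          then have "card U \<noteq> card (\<Union>(N ` U))" using False neq by metis
          moreover have "card U \<le> card (\<Union>(N ` U))" using U by (intro less.prems) auto
          ultimately have "card U \<le> card (\<Union>(N ` U)) - 1" by simp
          also have "\<dots> \<le> card (\<Union>(N ` U) - {y})" by (simp add: card_Diff_singleton_if)
          also have "\<Union>(N ` U) - {y} = \<Union>(N' ` U)" unfolding N'_def by auto
          finally show ?thesis .
        qed auto
      qed (use less.prems in \<open>auto simp: N'_def\<close>)
      then obtain g where g: "inj_on g (X - {x})" "\<And>z. z \<in> X - {x} \<Longrightarrow> g z \<in> N' z" by blast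
      have "inj_on (g(x := y)) X"
        using g unfolding inj_on_def N'_def by auto
      moreover have "\<forall>z\<in>X. (g(x := y)) z \<in> N z" using g y unfolding N'_def by auto
      ultimately show ?thesis by blast
    qed
  qed auto
qed

section \<open>Independent sets and their neighbours\<close>

definition independent_set :: "'v set set \<Rightarrow> 'v set \<Rightarrow> bool" where
  "independent_set E T \<longleftrightarrow> (\<forall>e\<in>E. \<not> e \<subseteq> T)"

definition neighbours :: "'v set set \<Rightarrow> 'v set \<Rightarrow> 'v set" where
  "neighbours E T = {y. \<exists>x\<in>T. {x, y} \<in> E}"

lemma edgeE:
  assumes "simple_graph V E" "e \<in> E"
  obtains x y where "e = {x, y}" "x \<noteq> y" "x \<in> V" "y \<in> V"
proof -
  have "card e = 2" "e \<subseteq> V" using assms unfolding simple_graph_def by auto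
  then show ?thesis using that by (auto simp: card_2_iff)
qed

lemma no_loops: "simple_graph V E \<Longrightarrow> {x, x} \<notin> E"
  unfolding simple_graph_def by force

lemma simple_graph_finite_edges: "simple_graph V E \<Longrightarrow> finite E"
  unfolding simple_graph_def by (auto intro: finite_subset[of E "Pow V"])

lemma vertex_cover_contains_minimal:
  assumes "finite V" "vertex_cover V E D"
  obtains C where "C \<subseteq> D" "minimal_vertex_cover V E C"
proof -
  have "finite {C. C \<subseteq> D \<and> vertex_cover V E C}"
    using assms by (auto simp: vertex_cover_def intro: finite_subset[of _ "Pow V"])
  from finite_has_minimal2[OF this, of D] assms(2)
  obtain C where C: "C \<subseteq> D" "vertex_cover V E C"
    "\<And>C'. C' \<subseteq> D \<Longrightarrow> vertex_cover V E C' \<Longrightarrow> C' \<subseteq> C \<Longrightarrow> C = C'" by auto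
  then have "minimal_vertex_cover V E C" unfolding minimal_vertex_cover_def by blast
  then show ?thesis using C that by blast
qed

lemma independent_Un:
  assumes "simple_graph V E" "independent_set E A" "independent_set E B" "neighbours E A \<inter> B = {}"
  shows "independent_set E (A \<union> B)"
  unfolding independent_set_def
proof (intro ballI notI)
  fix e assume e: "e \<in> E" "e \<subseteq> A \<union> B"
  from assms(1) e(1) obtain x y where xy: "e = {x, y}" by (rule edgeE)
  have "{x, y} \<in> E" "{y, x} \<in> E" using e xy by (auto simp: insert_commute)
  then have "\<not> (x \<in> A \<and> y \<in> B)" "\<not> (y \<in> A \<and> x \<in> B)"
    using assms(4) by (auto simp: neighbours_def)
  then have "e \<subseteq> A \<or> e \<subseteq> B" using e(2) xy by auto
  then show False using assms(2,3) e(1) by (auto simp: independent_set_def)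
qed

text \<open>An exchange argument: every maximal independent set has \<open>card V - h\<close>
  elements. Let J be maximal independent among the neighbours of T. The part of T adjacent to J has
  at most \<open>card J\<close> elements, since otherwise replacing J by T would give too large an
  independent set. The rest of T is handled by induction, and its neighbours avoid J.\<close>

lemma independent_card_le_neighbours:
  assumes G: "simple_graph V E" "no_isolated_vertices V E"
    and covers: "\<And>C. minimal_vertex_cover V E C \<Longrightarrow> card C = h"
    and T: "T \<subseteq> V" "independent_set E T"
  shows "card T \<le> card (neighbours E T)"
  using T
proof (induction "card T" arbitrary: T rule: less_induct)
  case (less T)
  note finV = G(1)[unfolded simple_graph_def, THEN conjunct1]
  have N_V: "neighbours E S \<subseteq> V" for S
    using G(1) unfolding simple_graph_def neighbours_def by blast
  have fin: "finite S" if "S \<subseteq> V" for S using that finV finite_subset by blast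
  \<comment> \<open>The complement of an independent set is a vertex cover; shrink it to a minimal
    one, of size h, and take complements again.\<close>
  have extend: "\<exists>B'. B \<subseteq> B' \<and> B' \<subseteq> V \<and> independent_set E B' \<and> card B' = card V - h"
    if "B \<subseteq> V" "independent_set E B" for B
  proof -
    have "vertex_cover V E (V - B)"
      using that G(1) unfolding vertex_cover_def independent_set_def simple_graph_def by blast
    then obtain C where C: "C \<subseteq> V - B" "minimal_vertex_cover V E C"
      using finV vertex_cover_contains_minimal by metis
    moreover have "independent_set E (V - C)"
      using C unfolding minimal_vertex_cover_def vertex_cover_def independent_set_def by blast
    moreover have "card (V - C) = card V - h"
      using C covers[of C] fin by (subst card_Diff_subset) auto
    ultimately show ?thesis using that by (intro exI[of _ "V - C"]) blast
  qed
  have upper: "card B \<le> card V - h" if B: "B \<subseteq> V" "independent_set E B" for B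
  proof -
    from extend[OF B] obtain B' where "B \<subseteq> B'" "B' \<subseteq> V" "card B' = card V - h" by blast
    then show ?thesis using card_mono[OF fin] by metis
  qed
  show ?case
  proof (cases "T = {}")
    case False
    then obtain t where t: "t \<in> T" by blast
    then obtain s where s: "{t, s} \<in> E"
    proof -
      obtain e where e: "e \<in> E" "t \<in> e"
        using t less.prems G(2) unfolding no_isolated_vertices_def by blast
      from G(1) e(1) obtain x y where "e = {x, y}" by (rule edgeE)
      then show ?thesis using e that by (cases "t = x") (auto simp: insert_commute)
    qed
    \<comment> \<open>Starting from {s} makes t a neighbour of J, so that T' is strictly smaller
      than T and the induction applies.\<close>
    have "finite {J. J \<subseteq> neighbours E T \<and> independent_set E J}"
      using finV N_V[of T] by (auto intro: finite_subset[of _ "Pow V"])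
    moreover have "independent_set E {s}"
      using G(1) by (auto simp: independent_set_def simple_graph_def subset_singleton_iff)
    then have "{s} \<in> {J. J \<subseteq> neighbours E T \<and> independent_set E J}"
      using s t by (auto simp: neighbours_def)
    ultimately have "\<exists>J\<in>{J. J \<subseteq> neighbours E T \<and> independent_set E J}. {s} \<subseteq> J \<and>
        (\<forall>J'\<in>{J. J \<subseteq> neighbours E T \<and> independent_set E J}. J \<subseteq> J' \<longrightarrow> J = J')"
      by (rule finite_has_maximal2)
    then obtain J where J: "s \<in> J" "J \<subseteq> neighbours E T" "independent_set E J"
      "\<And>J'. J' \<subseteq> neighbours E T \<Longrightarrow> independent_set E J' \<Longrightarrow> J \<subseteq> J' \<Longrightarrow> J = J'"
      by auto
    define T' where "T' = T - neighbours E J"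
    have T'V: "T' \<subseteq> V" and JV: "J \<subseteq> V" using less.prems J N_V unfolding T'_def by blast+
    have "t \<in> neighbours E J" using s J(1) by (auto simp: neighbours_def insert_commute)
    then have "card T' < card T"
      using t fin less.prems by (intro psubset_card_mono) (auto simp: T'_def)
    then have IH: "card T' \<le> card (neighbours E T')"
      using less.prems by (intro less.hyps) (auto simp: T'_def independent_set_def)
    have "neighbours E T' \<inter> J = {}"
    proof (intro Int_emptyI)
      fix y assume "y \<in> neighbours E T'" "y \<in> J"
      then obtain x where x: "x \<in> T'" "{x, y} \<in> E" "y \<in> J" by (auto simp: neighbours_def)
      then have "x \<in> neighbours E J" using insert_commute[of x y "{}"] by (auto simp: neighbours_def)
      then show False using x by (simp add: T'_def)
    qed
    then have "card (neighbours E T') + card J = card (neighbours E T' \<union> J)"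
      using fin N_V JV by (subst card_Un_disjoint) auto
    also have "\<dots> \<le> card (neighbours E T)"
      using J(2) fin N_V by (intro card_mono) (auto simp: T'_def neighbours_def)
    finally have 1: "card T' + card J \<le> card (neighbours E T)" using IH by simp
    have "independent_set E (J \<union> T')"
      using G(1) J(3) less.prems(2)
      by (intro independent_Un) (auto simp: T'_def independent_set_def)
    then obtain B where B: "J \<union> T' \<subseteq> B" "B \<subseteq> V" "independent_set E B" "card B = card V - h"
      using extend[of "J \<union> T'"] T'V JV by blast
    \<comment> \<open>The intersection is independent and contains J, so the maximality of J
      applies.\<close>
    have BJ: "B \<inter> neighbours E T = J"
      using B J by (intro J(4)[symmetric]) (auto simp: independent_set_def)
    \<comment> \<open>The exchange of J for T inside B: all neighbours of T in B have been removed
      together with J.\<close>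
    have "independent_set E (T \<union> (B - J))"
      using G(1) BJ B(3) less.prems(2) by (intro independent_Un) (auto simp: independent_set_def)
    then have "card (T \<union> (B - J)) \<le> card V - h"
      using less.prems B by (intro upper) auto
    \<comment> \<open>Elements of T - T' are adjacent to J, which lies in the independent set B, so
      they cannot lie in B themselves.\<close>
    moreover have "(B - J) \<inter> (T - T') = {}"
    proof (intro Int_emptyI)
      fix x assume x: "x \<in> B - J" "x \<in> T - T'"
      then obtain y where y: "y \<in> J" "{y, x} \<in> E" by (auto simp: T'_def neighbours_def)
      then have "{y, x} \<subseteq> B" using B(1) x by auto
      then show False using y B(3) by (auto simp: independent_set_def)
    qed
    then have "card ((B - J) \<union> (T - T')) = card (B - J) + card (T - T')"
      using fin B less.prems by (intro card_Un_disjoint) blast+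
    moreover have "card ((B - J) \<union> (T - T')) \<le> card (T \<union> (B - J))"
      using fin B less.prems by (intro card_mono) blast+
    moreover have "card (B - J) = card B - card J"
      using B(1) JV fin by (intro card_Diff_subset) auto
    moreover have "card J \<le> card B" using B(1,2) fin by (intro card_mono) auto
    ultimately have "card (T - T') \<le> card J" using B(4) by linarith
    moreover have "card (T - T') = card T - card T'"
      using T'V fin by (intro card_Diff_subset) (auto simp: T'_def)
    ultimately show ?thesis using 1 by linarith
  qed auto
qed

text \<open>The complement A of a minimal cover is independent and, as \<open>card V\<close> is 2h,
  has h elements. Hall's theorem sends A injectively to neighbours, which lie outside A, so the
  resulting edges are pairwise disjoint.\<close>

lemma perfect_matching_exists:
  assumes G: "simple_graph V E" "no_isolated_vertices V E"
    and covers: "\<And>C. minimal_vertex_cover V E C \<Longrightarrow> card C = h"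
    and h: "2 * h = card V"
  obtains M where "matching E M" "card M = h"
proof -
  note finV = G(1)[unfolded simple_graph_def, THEN conjunct1]
  have "vertex_cover V E V"
    using G(1) by (fastforce simp: vertex_cover_def simple_graph_def Int_absorb2)
  then obtain C where C: "minimal_vertex_cover V E C"
    using finV vertex_cover_contains_minimal by metis
  define A where "A = V - C"
  have indep: "independent_set E A" and CV: "C \<subseteq> V"
    using C unfolding A_def minimal_vertex_cover_def vertex_cover_def independent_set_def by blast+
  have cardA: "card A = h"
    using CV finV covers[OF C] h by (simp add: A_def card_Diff_subset finite_subset)
  have N: "\<Union> ((\<lambda>x. neighbours E {x}) ` T) = neighbours E T" for T
    by (auto simp: neighbours_def)
  have "\<exists>f. inj_on f A \<and> (\<forall>x\<in>A. f x \<in> neighbours E {x})"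
  proof (rule hall)
    show "finite A" using finV by (simp add: A_def)
    show "finite (neighbours E {x})" for x
      using G(1) finV by (auto simp: simple_graph_def neighbours_def intro!: finite_subset[of _ V])
    fix T assume "T \<subseteq> A"
    then have "T \<subseteq> V" "independent_set E T"
      using indep by (auto simp: A_def independent_set_def)
    then show "card T \<le> card (\<Union> ((\<lambda>x. neighbours E {x}) ` T))"
      unfolding N using independent_card_le_neighbours[OF G covers] by blast
  qed
  then obtain f where f: "inj_on f A" "\<And>x. x \<in> A \<Longrightarrow> {x, f x} \<in> E"
    by (auto simp: neighbours_def)
  have notA: "f x \<notin> A" if "x \<in> A" for x
    using f(2)[OF that] that indep unfolding independent_set_def by auto
  let ?M = "(\<lambda>x. {x, f x}) ` A"
  have inj: "inj_on (\<lambda>x. {x, f x}) A"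
    using notA by (auto simp: inj_on_def doubleton_eq_iff)
  have "{x, f x} \<inter> {y, f y} = {}" if "x \<in> A" "y \<in> A" "{x, f x} \<noteq> {y, f y}" for x y
    using that notA[of x] notA[of y] inj_onD[OF f(1), of x y] by force
  then have "matching E ?M"
    unfolding matching_def disjoint_def using f(2) by auto
  then show ?thesis using that inj cardA by (simp add: card_image)
qed

lemma matching_card_le:
  assumes "matching E M" "finite D" "\<And>e. e \<in> M \<Longrightarrow> e \<inter> D \<noteq> {}"
  shows "card M \<le> card D"
proof -
  have "\<forall>e\<in>M. \<exists>y. y \<in> e \<inter> D" using assms(3) by auto
  then obtain g where g: "\<And>e. e \<in> M \<Longrightarrow> g e \<in> e \<inter> D" by metis
  have "e = e'" if "e \<in> M" "e' \<in> M" "g e = g e'" for e e'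
    using g[OF that(1)] g[OF that(2)] that assms(1) unfolding matching_def
    by (metis Int_iff disjointD empty_iff)
  then have "inj_on g M" by (auto simp: inj_on_def)
  then show ?thesis using g assms(2) by (intro card_inj_on_le[of g]) auto
qed

section \<open>Sets meeting every k-matching\<close>

text \<open>In a simple graph these are the D for which \<open>variable_prime V D\<close> contains
  the k-th matching power of the edge ideal.\<close>

definition meets_matchings :: "'v set set \<Rightarrow> nat \<Rightarrow> 'v set \<Rightarrow> bool" where
  "meets_matchings E k D \<longleftrightarrow> (\<forall>M. matching E M \<and> card M = k \<longrightarrow> \<Union>M \<inter> D \<noteq> {})"

text \<open>At most k - 1 edges of M avoid D, since k of them would form a k-matching that misses D.
  Each remaining edge needs its own point of D.\<close>

lemma meets_matchings_card_ge:
  assumes "matching E M" "finite M" "finite D" "meets_matchings E k D" "1 \<le> k"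
  shows "card M + 1 \<le> card D + k"
proof -
  define L where "L = {e \<in> M. e \<inter> D = {}}"
  have sub: "matching E M'" if "M' \<subseteq> M" for M'
    using assms(1) that unfolding matching_def disjoint_def by blast
  have "card L < k"
  proof (rule ccontr)
    assume "\<not> card L < k"
    then obtain M' where M': "M' \<subseteq> L" "card M' = k" by (metis not_less obtain_subset_with_card_n)
    then have "matching E M'" by (intro sub) (auto simp: L_def)
    then show False using M' assms(4) unfolding meets_matchings_def L_def by blast
  qed
  moreover have "card (M - L) \<le> card D"
    by (intro matching_card_le[OF sub]) (auto simp: assms L_def)
  moreover have "card (M - L) = card M - card L"
    using assms(2) by (intro card_Diff_subset) (auto simp: L_def)
  ultimately show ?thesis by linarith
qed

text \<open>Pigeonhole: a k-matching that misses D would have k disjoint edges, each meeting C in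
  one of the k - 1 removed vertices.\<close>

lemma meets_matchings_exists:
  assumes "finite V" "vertex_cover V E C" "1 \<le> k" "k \<le> card C"
  obtains D where "D \<subseteq> C" "meets_matchings E k D" "card D + k = card C + 1"
proof -
  obtain D where D: "D \<subseteq> C" "card D = card C - k + 1"
  proof -
    have "card C - k + 1 \<le> card C" using assms(3,4) by linarith
    then show ?thesis using that by (rule obtain_subset_with_card_n)
  qed
  have fin: "finite C" using assms by (auto simp: vertex_cover_def finite_subset)
  have "meets_matchings E k D"
    unfolding meets_matchings_def
  proof (intro allI impI notI)
    fix M assume M: "matching E M \<and> card M = k" "\<Union>M \<inter> D = {}"
    have "card M \<le> card (C - D)"
    proof (rule matching_card_le)
      fix e assume "e \<in> M"
      then have "e \<inter> C \<noteq> {}" "e \<inter> D = {}"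
        using M assms(2) unfolding matching_def vertex_cover_def by blast+
      then show "e \<inter> (C - D) \<noteq> {}" by blast
    qed (use M fin in auto)
    also have "\<dots> = card C - card D" using D fin by (intro card_Diff_subset finite_subset[of D C])
    finally show False using M D assms by linarith
  qed
  then show ?thesis using that D assms(3,4) by force
qed

section \<open>The polynomial ring and its monomial ideals\<close>

lemma carrier_poly_ring_iff:
  "p \<in> carrier (poly_ring V) \<longleftrightarrow> (\<forall>m\<in>Poly_Mapping.keys p. Poly_Mapping.keys m \<subseteq> V)"
  by (simp add: poly_ring_def)

lemma poly_ring_simps [simp]:
  "mult (poly_ring V) = ((*) :: ('v, 'k::field) mpoly \<Rightarrow> _)"
  "one (poly_ring V) = (1 :: ('v, 'k) mpoly)"
  "zero (poly_ring V) = (0 :: ('v, 'k) mpoly)"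
  "add (poly_ring V) = ((+) :: ('v, 'k) mpoly \<Rightarrow> _)"
  by (simp_all add: poly_ring_def)

lemma keys_add_expo: "Poly_Mapping.keys (a + b :: 'v expo) = Poly_Mapping.keys a \<union> Poly_Mapping.keys b"
  by (auto simp: in_keys_iff lookup_add)

lemma poly_ring_add_closed:
  "p \<in> carrier (poly_ring V) \<Longrightarrow> q \<in> carrier (poly_ring V) \<Longrightarrow> p + q \<in> carrier (poly_ring V)"
  using Poly_Mapping.keys_add[of p q] unfolding carrier_poly_ring_iff by blast

lemma poly_ring_mult_closed:
  "p \<in> carrier (poly_ring V) \<Longrightarrow> q \<in> carrier (poly_ring V) \<Longrightarrow> p * q \<in> carrier (poly_ring V)"
  using keys_mult[of p q] by (fastforce simp: keys_add_expo carrier_poly_ring_iff)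

lemma cring_poly_ring: "cring (poly_ring V :: ('v, 'k::field) mpoly ring)"
proof (rule cringI)
  show "abelian_group (poly_ring V :: ('v, 'k) mpoly ring)"
  proof (rule abelian_groupI)
    fix p :: "('v, 'k) mpoly" assume "p \<in> carrier (poly_ring V)"
    then show "\<exists>q\<in>carrier (poly_ring V). q \<oplus>\<^bsub>poly_ring V\<^esub> p = \<zero>\<^bsub>poly_ring V\<^esub>"
      by (intro bexI[of _ "- p"]) (auto simp: in_keys_iff carrier_poly_ring_iff)
  qed (use poly_ring_add_closed in \<open>auto simp: ac_simps carrier_poly_ring_iff[of 0]\<close>)
  show "comm_monoid (poly_ring V :: ('v, 'k) mpoly ring)"
    by (rule comm_monoidI) (use poly_ring_mult_closed in \<open>auto simp: ac_simps carrier_poly_ring_iff[of 1]\<close>)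
qed (simp add: algebra_simps)

lemma poly_ring_a_inv:
  assumes "p \<in> carrier (poly_ring V :: ('v, 'k::field) mpoly ring)"
  shows "\<ominus>\<^bsub>poly_ring V\<^esub> p = - p"
proof -
  interpret cring "poly_ring V :: ('v, 'k) mpoly ring" by (rule cring_poly_ring)
  have "- p \<in> carrier (poly_ring V)" using assms by (auto simp: in_keys_iff carrier_poly_ring_iff)
  then show ?thesis using assms by (intro minus_equality) auto
qed

lemma poly_mapping_sum_single:
  "(\<Sum>m\<in>Poly_Mapping.keys p. Poly_Mapping.single m (Poly_Mapping.lookup p m)) = p"
proof (rule poly_mapping_eqI)
  fix k
  have "(\<Sum>m\<in>Poly_Mapping.keys p. Poly_Mapping.lookup (Poly_Mapping.single m (Poly_Mapping.lookup p m)) k)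
      = (\<Sum>m\<in>Poly_Mapping.keys p. if m = k then Poly_Mapping.lookup p m else 0)"
    by (intro sum.cong) (auto simp: lookup_single when_def)
  then show "Poly_Mapping.lookup (\<Sum>m\<in>Poly_Mapping.keys p. Poly_Mapping.single m (Poly_Mapping.lookup p m)) k
      = Poly_Mapping.lookup p k"
    by (simp add: lookup_sum sum.delta in_keys_iff)
qed

lemma ideal_poly_ring_sum:
  assumes "ideal I (poly_ring V :: ('v, 'k::field) mpoly ring)" "\<And>i. i \<in> A \<Longrightarrow> f i \<in> I"
  shows "(\<Sum>i\<in>A. f i) \<in> I"
proof -
  interpret ideal I "poly_ring V :: ('v, 'k) mpoly ring" by fact
  show ?thesis using assms(2)
    by (induction A rule: infinite_finite_induct)
      (use additive_subgroup.zero_closed[OF is_additive_subgroup]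
        additive_subgroup.a_closed[OF is_additive_subgroup] in auto)
qed

lemma ideal_poly_ring_diff:
  assumes "ideal I (poly_ring V :: ('v, 'k::field) mpoly ring)" "p \<in> I" "q \<in> I"
  shows "p - q \<in> I"
proof -
  interpret ideal I "poly_ring V :: ('v, 'k) mpoly ring" by fact
  have "q \<in> carrier (poly_ring V)" using assms(3) a_Hcarr by blast
  then have "- q \<in> I"
    using additive_subgroup.a_inv_closed[OF is_additive_subgroup assms(3)] poly_ring_a_inv by metis
  then show ?thesis
    using additive_subgroup.a_closed[OF is_additive_subgroup assms(2), of "- q"] by simp
qed

section \<open>Monomial ideals described by supports\<close>

text \<open>Membership is a condition on each monomial of p separately, which reduces containments
  to divisibility of exponent vectors. That this is the ideal generated by B is
  \<open>genideal_monomials\<close>.\<close>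

definition monomial_ideal :: "'v set \<Rightarrow> 'v expo set \<Rightarrow> ('v, 'k::field) mpoly set" where
  "monomial_ideal V B =
     {p. \<forall>m\<in>Poly_Mapping.keys p. Poly_Mapping.keys m \<subseteq> V \<and> (\<exists>b\<in>B. \<exists>c. m = b + c)}"

lemma monomial_ideal_is_ideal: "ideal (monomial_ideal V B) (poly_ring V :: ('v, 'k::field) mpoly ring)"
proof -
  interpret cring "poly_ring V :: ('v, 'k) mpoly ring" by (rule cring_poly_ring)
  have mult: "p * q \<in> monomial_ideal V B"
    if "p \<in> monomial_ideal V B" "q \<in> carrier (poly_ring V)" for p q :: "('v, 'k) mpoly"
    unfolding monomial_ideal_def
  proof (intro CollectI ballI)
    fix m assume "m \<in> Poly_Mapping.keys (p * q)"
    then obtain a b where ab: "m = a + b" "a \<in> Poly_Mapping.keys p" "b \<in> Poly_Mapping.keys q"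
      using keys_mult[of p q] by blast
    then have "\<exists>d\<in>B. \<exists>c. a = d + c" "Poly_Mapping.keys a \<subseteq> V" "Poly_Mapping.keys b \<subseteq> V"
      using that by (auto simp: monomial_ideal_def carrier_poly_ring_iff)
    then obtain d c where "d \<in> B" "a = d + c" "Poly_Mapping.keys a \<subseteq> V" "Poly_Mapping.keys b \<subseteq> V"
      by blast
    then show "Poly_Mapping.keys m \<subseteq> V \<and> (\<exists>b\<in>B. \<exists>c. m = b + c)"
      using ab by (auto simp: keys_add_expo add.assoc)
  qed
  show ?thesis
  proof (rule idealI)
    show "subgroup (monomial_ideal V B) (add_monoid (poly_ring V :: ('v, 'k) mpoly ring))"
    proof (rule add.subgroupI)
      show "monomial_ideal V B \<subseteq> (carrier (poly_ring V) :: ('v, 'k) mpoly set)"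
        by (auto simp: monomial_ideal_def carrier_poly_ring_iff)
      have "0 \<in> monomial_ideal V B" by (simp add: monomial_ideal_def)
      then show "monomial_ideal V B \<noteq> {}" by blast
      fix p q :: "('v, 'k) mpoly" assume p: "p \<in> monomial_ideal V B"
      then have "p \<in> carrier (poly_ring V)" by (simp add: monomial_ideal_def carrier_poly_ring_iff)
      then show "\<ominus>\<^bsub>poly_ring V\<^esub> p \<in> monomial_ideal V B"
        using p by (subst poly_ring_a_inv) (auto simp: monomial_ideal_def in_keys_iff)
      assume "q \<in> monomial_ideal V B"
      then show "p \<oplus>\<^bsub>poly_ring V\<^esub> q \<in> monomial_ideal V B"
        using p Poly_Mapping.keys_add[of p q] by (fastforce simp: monomial_ideal_def)
    qed
  qed (use mult in \<open>auto simp: mult.commute\<close>, (unfold_locales)?)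
qed

lemma genideal_monomials:
  assumes "\<And>b. b \<in> B \<Longrightarrow> Poly_Mapping.keys b \<subseteq> V"
  shows "Idl\<^bsub>poly_ring V\<^esub> (mon ` B) = (monomial_ideal V B :: ('v, 'k::field) mpoly set)"
proof
  interpret cring "poly_ring V :: ('v, 'k) mpoly ring" by (rule cring_poly_ring)
  have "mon b \<in> (monomial_ideal V B :: ('v, 'k) mpoly set)" if "b \<in> B" for b
    using assms[OF that] that by (auto simp: monomial_ideal_def mon_def intro!: exI[of _ 0] bexI[of _ b])
  then show "Idl\<^bsub>poly_ring V\<^esub> (mon ` B) \<subseteq> (monomial_ideal V B :: ('v, 'k) mpoly set)"
    by (intro genideal_minimal monomial_ideal_is_ideal) blast
  have BV: "mon ` B \<subseteq> carrier (poly_ring V :: ('v, 'k) mpoly ring)"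
    using assms by (auto simp: mon_def carrier_poly_ring_iff)
  interpret J: ideal "Idl\<^bsub>poly_ring V\<^esub> (mon ` B)" "poly_ring V :: ('v, 'k) mpoly ring"
    using genideal_ideal[OF BV] .
  show "monomial_ideal V B \<subseteq> (Idl\<^bsub>poly_ring V\<^esub> (mon ` B) :: ('v, 'k) mpoly set)"
  proof
    fix p :: "('v, 'k) mpoly" assume p: "p \<in> monomial_ideal V B"
    have "Poly_Mapping.single m (Poly_Mapping.lookup p m) \<in> Idl\<^bsub>poly_ring V\<^esub> (mon ` B)"
      if m: "m \<in> Poly_Mapping.keys p" for m
    proof -
      from p m obtain b c where bc: "b \<in> B" "m = b + c" "Poly_Mapping.keys m \<subseteq> V"
        by (auto simp: monomial_ideal_def)
      then have "Poly_Mapping.single c (Poly_Mapping.lookup p m) \<in> carrier (poly_ring V)"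
        by (auto simp: keys_add_expo carrier_poly_ring_iff)
      moreover have "mon b \<in> Idl\<^bsub>poly_ring V\<^esub> (mon ` B :: ('v, 'k) mpoly set)"
        using genideal_self[OF BV] bc by blast
      ultimately have "mon b * Poly_Mapping.single c (Poly_Mapping.lookup p m) \<in> Idl\<^bsub>poly_ring V\<^esub> (mon ` B)"
        using J.I_r_closed by fastforce
      then show ?thesis by (simp add: mon_def mult_single bc)
    qed
    then have "(\<Sum>m\<in>Poly_Mapping.keys p. Poly_Mapping.single m (Poly_Mapping.lookup p m))
        \<in> Idl\<^bsub>poly_ring V\<^esub> (mon ` B)"
      by (intro ideal_poly_ring_sum[OF J.is_ideal])
    then show "p \<in> Idl\<^bsub>poly_ring V\<^esub> (mon ` B)" by (simp add: poly_mapping_sum_single)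
  qed
qed

lemma mon_in_monomial_ideal_iff:
  "(mon m :: ('v, 'k::field) mpoly) \<in> monomial_ideal V B \<longleftrightarrow>
     Poly_Mapping.keys m \<subseteq> V \<and> (\<exists>b\<in>B. \<exists>c. m = b + c)"
  by (simp add: monomial_ideal_def mon_def)

text \<open>This takes the place of a monomial order: a and b are lexicographically largest. In the
  induction only the elements with the largest exponent at v are kept; a sum reaching both maxima at
  v must have both summands among them. The use is that the coefficient at a + b of a product of
  polynomials cannot cancel.\<close>

lemma unique_sum_exists:
  fixes A B :: "'v expo set"
  assumes "finite W" "finite A" "finite B" "A \<noteq> {}" "B \<noteq> {}"
    and "\<And>a a' v. a \<in> A \<Longrightarrow> a' \<in> A \<Longrightarrow> v \<notin> W \<Longrightarrow> Poly_Mapping.lookup a v = Poly_Mapping.lookup a' v"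
    and "\<And>a a' v. a \<in> B \<Longrightarrow> a' \<in> B \<Longrightarrow> v \<notin> W \<Longrightarrow> Poly_Mapping.lookup a v = Poly_Mapping.lookup a' v"
  shows "\<exists>a\<in>A. \<exists>b\<in>B. \<forall>a'\<in>A. \<forall>b'\<in>B. a' + b' = a + b \<longrightarrow> a' = a \<and> b' = b"
  using assms
proof (induction W arbitrary: A B rule: finite_induct)
  case empty
  have A: "a = a'" if "a \<in> A" "a' \<in> A" for a a'
    by (rule poly_mapping_eqI) (use empty.prems(5)[OF that] in simp)
  have B: "b = b'" if "b \<in> B" "b' \<in> B" for b b'
    by (rule poly_mapping_eqI) (use empty.prems(6)[OF that] in simp)
  from empty.prems(3,4) obtain a b where "a \<in> A" "b \<in> B" by auto
  then show ?case using A B by (intro bexI[of _ a] bexI[of _ b]) auto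
next
  case (insert v W)
  let ?top = "\<lambda>X. {a \<in> X. \<forall>a'\<in>X. Poly_Mapping.lookup a' v \<le> Poly_Mapping.lookup a v}"
  have top: "?top X \<noteq> {}" if "finite X" "X \<noteq> {}" for X :: "'v expo set"
  proof -
    have "Max ((\<lambda>a. Poly_Mapping.lookup a v) ` X) \<in> (\<lambda>a. Poly_Mapping.lookup a v) ` X"
      using that by (intro Max_in) auto
    then obtain a where "a \<in> X" "Poly_Mapping.lookup a v = Max ((\<lambda>a. Poly_Mapping.lookup a v) ` X)" by auto
    then have "a \<in> ?top X" using that by simp
    then show ?thesis by blast
  qed
  have eq: "Poly_Mapping.lookup a u = Poly_Mapping.lookup a' u"
    if "a \<in> ?top X" "a' \<in> ?top X" "u \<notin> W"
      "\<And>a a' u. a \<in> X \<Longrightarrow> a' \<in> X \<Longrightarrow> u \<notin> insert v W \<Longrightarrow> Poly_Mapping.lookup a u = Poly_Mapping.lookup a' u"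
    for X :: "'v expo set" and a a' u
  proof (cases "u = v")
    case True
    moreover have "Poly_Mapping.lookup a v \<le> Poly_Mapping.lookup a' v"
      "Poly_Mapping.lookup a' v \<le> Poly_Mapping.lookup a v" using that(1,2) by auto
    ultimately show ?thesis by simp
  next
    case False
    then show ?thesis using that by auto
  qed
  have "\<exists>a\<in>?top A. \<exists>b\<in>?top B. \<forall>a'\<in>?top A. \<forall>b'\<in>?top B. a' + b' = a + b \<longrightarrow> a' = a \<and> b' = b"
  proof (rule insert.IH)
    show "Poly_Mapping.lookup a u = Poly_Mapping.lookup a' u" if "a \<in> ?top A" "a' \<in> ?top A" "u \<notin> W" for a a' u
      using eq[OF that] insert.prems(5) by blast
    show "Poly_Mapping.lookup a u = Poly_Mapping.lookup a' u" if "a \<in> ?top B" "a' \<in> ?top B" "u \<notin> W" for a a' u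
      using eq[OF that] insert.prems(6) by blast
  qed (use insert.prems top in auto)
  then obtain a b where ab: "a \<in> ?top A" "b \<in> ?top B"
    "\<And>a' b'. a' \<in> ?top A \<Longrightarrow> b' \<in> ?top B \<Longrightarrow> a' + b' = a + b \<Longrightarrow> a' = a \<and> b' = b" by blast
  have "a' = a \<and> b' = b" if *: "a' \<in> A" "b' \<in> B" "a' + b' = a + b" for a' b'
  proof (rule ab(3))
    have "Poly_Mapping.lookup a' v + Poly_Mapping.lookup b' v = Poly_Mapping.lookup a v + Poly_Mapping.lookup b v"
      using *(3) by (metis lookup_add)
    moreover have "Poly_Mapping.lookup a' v \<le> Poly_Mapping.lookup a v"
      "Poly_Mapping.lookup b' v \<le> Poly_Mapping.lookup b v" using ab(1,2) * by auto
    ultimately have "Poly_Mapping.lookup a' v = Poly_Mapping.lookup a v"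
      "Poly_Mapping.lookup b' v = Poly_Mapping.lookup b v" by linarith+
    then show "a' \<in> ?top A" "b' \<in> ?top B" using ab(1,2) * by auto
  qed (rule *)
  then show ?case using ab(1,2) by blast
qed

section \<open>Prime ideals generated by variables\<close>

definition variable_prime :: "'v set \<Rightarrow> 'v set \<Rightarrow> ('v, 'k::field) mpoly set" where
  "variable_prime V C =
     {p. \<forall>m\<in>Poly_Mapping.keys p. Poly_Mapping.keys m \<subseteq> V \<and> Poly_Mapping.keys m \<inter> C \<noteq> {}}"

lemma expo_split_variable:
  assumes "v \<in> Poly_Mapping.keys (m :: 'v expo)"
  shows "\<exists>c. m = Poly_Mapping.single v 1 + c"
proof
  show "m = Poly_Mapping.single v 1 + (m - Poly_Mapping.single v 1)"
    using assms by (intro poly_mapping_eqI) (auto simp: lookup_add lookup_minus lookup_single when_def in_keys_iff)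
qed

lemma variable_prime_eq_monomial_ideal:
  "variable_prime V C = monomial_ideal V ((\<lambda>v. Poly_Mapping.single v 1) ` C)"
  unfolding variable_prime_def monomial_ideal_def
  by (intro Collect_cong ball_cong refl conj_cong) (use expo_split_variable in \<open>fastforce simp: keys_add_expo\<close>)

lemma variable_prime_genideal:
  assumes "C \<subseteq> V"
  shows "Idl\<^bsub>poly_ring V\<^esub> (var ` C) = (variable_prime V C :: ('v, 'k::field) mpoly set)"
proof -
  have "var ` C = (mon ` (\<lambda>v. Poly_Mapping.single v 1) ` C :: ('v, 'k) mpoly set)"
    by (simp add: image_image var_def)
  then show ?thesis
    using assms by (simp only: variable_prime_eq_monomial_ideal) (subst genideal_monomials, auto)
qed

lemma variable_prime_subset_ideal:
  assumes "ideal I (poly_ring V :: ('v, 'k::field) mpoly ring)" "C \<subseteq> V" "var ` C \<subseteq> I"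
  shows "variable_prime V C \<subseteq> I"
proof -
  interpret cring "poly_ring V :: ('v, 'k) mpoly ring" by (rule cring_poly_ring)
  show ?thesis using genideal_minimal[OF assms(1,3)] variable_prime_genideal[OF assms(2)] by metis
qed

text \<open>Among the monomials of p and of q that avoid C, take a and b with a unique sum. A factor
  of a monomial avoiding C avoids C as well, so no other pair contributes to the coefficient of a +
  b in p * q, and that coefficient is a product of two nonzero field elements.\<close>

lemma variable_prime_primeideal:
  assumes "finite V"
  shows "primeideal (variable_prime V C) (poly_ring V :: ('v, 'k::field) mpoly ring)"
proof (rule primeidealI)
  show "ideal (variable_prime V C) (poly_ring V :: ('v, 'k) mpoly ring)"
    unfolding variable_prime_eq_monomial_ideal by (rule monomial_ideal_is_ideal)
  show "cring (poly_ring V :: ('v, 'k) mpoly ring)" by (rule cring_poly_ring)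
  have "1 \<notin> (variable_prime V C :: ('v, 'k) mpoly set)" by (simp add: variable_prime_def)
  moreover have "1 \<in> carrier (poly_ring V :: ('v, 'k) mpoly ring)" by (simp add: carrier_poly_ring_iff)
  ultimately show "carrier (poly_ring V :: ('v, 'k) mpoly ring) \<noteq> variable_prime V C" by metis
  fix p q :: "('v, 'k) mpoly"
  assume pq: "p \<in> carrier (poly_ring V)" "q \<in> carrier (poly_ring V)"
    "p \<otimes>\<^bsub>poly_ring V\<^esub> q \<in> variable_prime V C"
  show "p \<in> variable_prime V C \<or> q \<in> variable_prime V C"
  proof (rule ccontr)
    let ?A = "\<lambda>p. {m \<in> Poly_Mapping.keys p. Poly_Mapping.keys m \<inter> C = {}}"
    assume "\<not> ?thesis"
    then have "?A p \<noteq> {}" "?A q \<noteq> {}" using pq(1,2) by (auto simp: variable_prime_def carrier_poly_ring_iff)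
    then have "\<exists>a\<in>?A p. \<exists>b\<in>?A q. \<forall>a'\<in>?A p. \<forall>b'\<in>?A q. a' + b' = a + b \<longrightarrow> a' = a \<and> b' = b"
    proof (intro unique_sum_exists[of V])
      show "Poly_Mapping.lookup a v = Poly_Mapping.lookup a' v"
        if "a \<in> ?A p" "a' \<in> ?A p" "v \<notin> V" for a a' v
      proof -
        have "v \<notin> Poly_Mapping.keys a" "v \<notin> Poly_Mapping.keys a'"
          using that pq(1) by (auto simp: carrier_poly_ring_iff)
        then show ?thesis by (simp add: in_keys_iff)
      qed
      show "Poly_Mapping.lookup a v = Poly_Mapping.lookup a' v"
        if "a \<in> ?A q" "a' \<in> ?A q" "v \<notin> V" for a a' v
      proof -
        have "v \<notin> Poly_Mapping.keys a" "v \<notin> Poly_Mapping.keys a'"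
          using that pq(2) by (auto simp: carrier_poly_ring_iff)
        then show ?thesis by (simp add: in_keys_iff)
      qed
    qed (use assms pq in \<open>auto simp: carrier_poly_ring_iff\<close>)
    then obtain a b where ab: "a \<in> ?A p" "b \<in> ?A q"
      "\<And>a' b'. a' \<in> ?A p \<Longrightarrow> b' \<in> ?A q \<Longrightarrow> a' + b' = a + b \<Longrightarrow> a' = a \<and> b' = b" by blast
    have disj: "Poly_Mapping.keys (a + b) \<inter> C = {}" using ab(1,2) by (auto simp: keys_add_expo)
    have uniq: "l = a \<and> r = b"
      if "l \<in> Poly_Mapping.keys p" "r \<in> Poly_Mapping.keys q" "a + b = l + r" for l r
      using that disj by (intro ab(3)) (auto simp: keys_add_expo)
    have "Poly_Mapping.lookup (p * q) (a + b) =
        (\<Sum>l. Poly_Mapping.lookup p l * (\<Sum>r. Poly_Mapping.lookup q r when a + b = l + r))"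
      by (simp add: lookup_mult)
    also have "\<dots> = (\<Sum>l. Poly_Mapping.lookup p a * Poly_Mapping.lookup q b when l = a)"
    proof (rule Sum_any.cong)
      fix l
      show "Poly_Mapping.lookup p l * (\<Sum>r. Poly_Mapping.lookup q r when a + b = l + r)
          = (Poly_Mapping.lookup p a * Poly_Mapping.lookup q b when l = a)"
      proof (cases "l = a")
        case False
        have "(Poly_Mapping.lookup p l * (\<Sum>r. Poly_Mapping.lookup q r when a + b = l + r)) = 0"
        proof (cases "l \<in> Poly_Mapping.keys p")
          case True
          then have "(Poly_Mapping.lookup q r when a + b = l + r) = 0" for r
            using uniq[of l r] False by (auto simp: when_def in_keys_iff)
          then show ?thesis by simp
        qed (simp add: in_keys_iff)
        then show ?thesis using False by simp
      qed simp
    qed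
    also have "\<dots> = Poly_Mapping.lookup p a * Poly_Mapping.lookup q b" by simp
    also have "\<dots> \<noteq> 0" using ab(1,2) by (simp add: in_keys_iff)
    finally have "a + b \<in> Poly_Mapping.keys (p * q)" by (simp add: in_keys_iff)
    then show False using pq(3) disj by (auto simp: variable_prime_def)
  qed
qed

section \<open>Chains of prime ideals\<close>

text \<open>Gaussian elimination, with I indexing the unknowns and J the equations. The matrix A' is
  what remains of A after the unknown at the pivot h has been eliminated by means of equation
  j.\<close>

lemma homogeneous_system_nontrivial_solution:
  fixes A :: "'i \<Rightarrow> 'j \<Rightarrow> 'k::field"
  assumes "finite J" "finite I" "card J < card I"
  shows "\<exists>q. (\<exists>i\<in>I. q i \<noteq> 0) \<and> (\<forall>j\<in>J. (\<Sum>i\<in>I. q i * A i j) = 0)"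
  using assms
proof (induction J arbitrary: I A rule: finite_induct)
  case empty
  then have "I \<noteq> {}" by auto
  then show ?case by (intro exI[of _ "\<lambda>_. 1"]) auto
next
  case (insert j J)
  show ?case
  proof (cases "\<forall>i\<in>I. A i j = 0")
    case True
    have "card J < card I" using insert by simp
    then obtain q where "\<exists>i\<in>I. q i \<noteq> 0" "\<forall>j\<in>J. (\<Sum>i\<in>I. q i * A i j) = 0"
      using insert.IH[of I A] insert.prems by blast
    then show ?thesis using True by (intro exI[of _ q]) auto
  next
    case False
    then obtain h where h: "h \<in> I" "A h j \<noteq> 0" by blast
    define A' where "A' i l = A i l - A i j / A h j * A h l" for i l
    have "card J < card (I - {h})" using insert h by simp
    then obtain q where q: "\<exists>i\<in>I - {h}. q i \<noteq> 0" "\<And>l. l \<in> J \<Longrightarrow> (\<Sum>i\<in>I - {h}. q i * A' i l) = 0"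
      using insert.IH[of "I - {h}" A'] insert.prems by auto
    \<comment> \<open>The value at h is the one that equation j forces.\<close>
    define r where "r = q(h := - (\<Sum>i\<in>I - {h}. q i * A i j) / A h j)"
    have split: "(\<Sum>i\<in>I. r i * A i l) = r h * A h l + (\<Sum>i\<in>I - {h}. q i * A i l)" for l
    proof -
      have "(\<Sum>i\<in>I. r i * A i l) = r h * A h l + (\<Sum>i\<in>I - {h}. r i * A i l)"
        using insert.prems h by (intro sum.remove) auto
      also have "(\<Sum>i\<in>I - {h}. r i * A i l) = (\<Sum>i\<in>I - {h}. q i * A i l)"
        by (intro sum.cong) (auto simp: r_def)
      finally show ?thesis .
    qed
    have "(\<Sum>i\<in>I. r i * A i l) = 0" if "l \<in> insert j J" for l
    proof (cases "l = j")
      case True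
      then show ?thesis using h by (subst split) (simp add: r_def)
    next
      case False
      then have "(\<Sum>i\<in>I - {h}. q i * A' i l) = 0" using q that by auto
      also have "(\<Sum>i\<in>I - {h}. q i * A' i l) =
          (\<Sum>i\<in>I - {h}. q i * A i l - q i * A i j * (A h l / A h j))"
        by (intro sum.cong) (auto simp: A'_def field_simps)
      also have "\<dots> = (\<Sum>i\<in>I - {h}. q i * A i l) - (\<Sum>i\<in>I - {h}. q i * A i j) * (A h l / A h j)"
        by (simp only: sum_subtractf sum_distrib_right)
      finally show ?thesis by (subst split) (simp add: r_def)
    qed
    moreover have "\<exists>i\<in>I. r i \<noteq> 0" using q(1) by (auto simp: r_def)
    ultimately show ?thesis by blast
  qed
qed

section \<open>Counting monomials\<close>

text \<open>Bounding each exponent instead of the total degree makes the number of admissible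
  monomials a plain power of the bound plus one.\<close>

definition exponents_le :: "nat \<Rightarrow> ('v, 'k::field) mpoly \<Rightarrow> bool" where
  "exponents_le D p \<longleftrightarrow> (\<forall>m\<in>Poly_Mapping.keys p. \<forall>v. Poly_Mapping.lookup m v \<le> D)"

lemma exponents_le_mult:
  "exponents_le D p \<Longrightarrow> exponents_le D' q \<Longrightarrow> exponents_le (D + D') (p * q)"
  using keys_mult[of p q] unfolding exponents_le_def by (fastforce simp: lookup_add intro: add_mono)

lemma exponents_le_one: "exponents_le 0 1"
  by (simp add: exponents_le_def)

lemma exponents_le_power: "exponents_le D p \<Longrightarrow> exponents_le (n * D) (p ^ n)"
  by (induction n) (auto simp: exponents_le_one intro: exponents_le_mult)

lemma exponents_le_prod:
  assumes "\<And>i. i \<in> A \<Longrightarrow> exponents_le (D i) (f i)"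
  shows "exponents_le (\<Sum>i\<in>A. D i) (\<Prod>i\<in>A. f i)"
  using assms
  by (induction A rule: infinite_finite_induct) (auto simp: exponents_le_one intro: exponents_le_mult)

lemma exponents_le_mono: "exponents_le D p \<Longrightarrow> D \<le> D' \<Longrightarrow> exponents_le D' p"
  unfolding exponents_le_def using le_trans by blast

lemma exponents_le_exists: "\<exists>D. exponents_le D p"
proof -
  let ?X = "\<Union>m\<in>Poly_Mapping.keys p. Poly_Mapping.lookup m ` Poly_Mapping.keys m"
  have "finite ?X" by simp
  then obtain D where D: "\<And>x. x \<in> ?X \<Longrightarrow> x \<le> D" unfolding finite_nat_set_iff_bounded_le by blast
  have "Poly_Mapping.lookup m v \<le> D" if "m \<in> Poly_Mapping.keys p" for m v
  proof (cases "v \<in> Poly_Mapping.keys m")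
    case True
    then show ?thesis using that by (intro D) auto
  qed (simp add: in_keys_iff)
  then show ?thesis unfolding exponents_le_def by blast
qed

lemma bounded_expos:
  fixes N :: nat
  assumes "finite V"
  defines "J \<equiv> {m :: 'v expo. Poly_Mapping.keys m \<subseteq> V \<and> (\<forall>v. Poly_Mapping.lookup m v \<le> N)}"
  shows "finite J" "card J \<le> (N + 1) ^ card V"
proof -
  let ?f = "\<lambda>m. restrict (Poly_Mapping.lookup m) V"
  have inj: "inj_on ?f J"
  proof (rule inj_onI, rule poly_mapping_eqI)
    fix a b v assume ab: "a \<in> J" "b \<in> J" "?f a = ?f b"
    show "Poly_Mapping.lookup a v = Poly_Mapping.lookup b v"
    proof (cases "v \<in> V")
      case True
      then show ?thesis using ab(3) by (metis restrict_apply')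
    next
      case False
      then have "v \<notin> Poly_Mapping.keys a" "v \<notin> Poly_Mapping.keys b" using ab by (auto simp: J_def)
      then show ?thesis by (simp add: in_keys_iff)
    qed
  qed
  have sub: "?f ` J \<subseteq> (V \<rightarrow>\<^sub>E {..N})" by (auto simp: J_def)
  have fin: "finite (V \<rightarrow>\<^sub>E {..N})" using assms by (intro finite_PiE) auto
  show "finite J" using finite_imageD[OF finite_subset[OF sub fin] inj] .
  have "card J \<le> card (V \<rightarrow>\<^sub>E {..N})" by (rule card_inj_on_le[OF inj sub fin])
  then show "card J \<le> (N + 1) ^ card V" using assms by (simp add: card_PiE)
qed

lemma lookup_single_zero_mult:
  "Poly_Mapping.lookup (Poly_Mapping.single 0 c * p) m = c * Poly_Mapping.lookup p (m :: 'v expo)"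
proof -
  have "Poly_Mapping.lookup (Poly_Mapping.single 0 c * p) m
      = (\<Sum>l. Poly_Mapping.lookup (Poly_Mapping.single 0 c) l * (\<Sum>q. Poly_Mapping.lookup p q when m = l + q))"
    by (rule lookup_mult)
  also have "\<dots> = (\<Sum>l. c * (\<Sum>q. Poly_Mapping.lookup p q when m = l + q) when l = 0)"
    by (intro Sum_any.cong) (auto simp: lookup_single when_def)
  also have "\<dots> = c * Poly_Mapping.lookup p m" by (simp add: eq_commute[of m])
  finally show ?thesis .
qed

lemma poly_ring_one_closed: "1 \<in> carrier (poly_ring V)"
  by (simp add: carrier_poly_ring_iff)

lemma poly_ring_power_closed: "p \<in> carrier (poly_ring V) \<Longrightarrow> p ^ n \<in> carrier (poly_ring V)"
  by (induction n) (auto intro: poly_ring_one_closed poly_ring_mult_closed)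

lemma poly_ring_prod_power_closed:
  "(\<And>i. i \<in> X \<Longrightarrow> a i \<in> carrier (poly_ring V)) \<Longrightarrow> (\<Prod>i\<in>X. a i ^ f i) \<in> carrier (poly_ring V)"
  by (induction X rule: infinite_finite_induct)
    (auto intro: poly_ring_one_closed poly_ring_mult_closed poly_ring_power_closed)

text \<open>A counting argument: the monomials in \<open>l > card (V - W)\<close> polynomials with exponents at
  most \<open>N\<close> outnumber the monomials in the variables \<open>V - W\<close> that can occur in them
  once \<open>N\<close> is large.\<close>

lemma algebraic_relation_mod_variable_prime:
  fixes a :: "nat \<Rightarrow> ('v, 'k::field) mpoly"
  assumes "finite V" "\<And>i. i < l \<Longrightarrow> a i \<in> carrier (poly_ring V)" "card (V - W) < l"
  shows "\<exists>A q. finite A \<and> A \<noteq> {} \<and> (\<forall>e\<in>A. q e \<noteq> 0) \<and> A \<subseteq> extensional {..<l} \<and>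
    (\<Sum>e\<in>A. Poly_Mapping.single 0 (q e) * (\<Prod>i<l. a i ^ e i)) \<in> variable_prime V W"
proof -
  have "\<exists>D. \<forall>i. exponents_le (D i) (a i)" by (intro choice allI exponents_le_exists)
  then obtain D' where D': "\<And>i. exponents_le (D' i) (a i)" by blast
  define D where "D = (\<Sum>i<l. D' i)"
  have D: "exponents_le D (a i)" if "i < l" for i
    using that by (intro exponents_le_mono[OF D'[of i]]) (auto simp: D_def intro: member_le_sum)
  define d where "d = card (V - W)"
  \<comment> \<open>Chosen so that ((l * D + 1) * (N + 1))^d equals N * (N + 1)^d, which is less
    than (N + 1)^(d + 1) and hence less than the number (N + 1)^l of exponent functions.\<close>
  define N where "N = (l * D + 1) ^ d"
  \<comment> \<open>Functions in \<open>PiE\<close> are determined by their values below l, so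
    distinct elements of I differ at some index of the product.\<close>
  define I :: "(nat \<Rightarrow> nat) set" where "I = ({..<l} \<rightarrow>\<^sub>E {..N})"
  \<comment> \<open>Only monomials avoiding W impose an equation; those meeting W lie in
    \<open>variable_prime V W\<close> already.\<close>
  define J :: "'v expo set" where
    "J = {m. Poly_Mapping.keys m \<subseteq> V - W \<and> (\<forall>v. Poly_Mapping.lookup m v \<le> l * (N * D))}"
  have finI: "finite I" unfolding I_def by (intro finite_PiE) auto
  have J: "finite J" "card J \<le> (l * (N * D) + 1) ^ d"
    using bounded_expos[of "V - W" "l * (N * D)"] assms(1) by (simp_all only: J_def d_def finite_Diff)
  note J(2)
  also have "(l * (N * D) + 1) ^ d \<le> ((l * D + 1) * (N + 1)) ^ d"
    by (intro power_mono) (auto simp: algebra_simps)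
  also have "\<dots> = N * (N + 1) ^ d" unfolding power_mult_distrib by (simp only: N_def)
  also have "\<dots> < (N + 1) * (N + 1) ^ d" by simp
  also have "\<dots> = (N + 1) ^ Suc d" by simp
  also have "\<dots> \<le> (N + 1) ^ l" using assms(3) by (intro power_increasing) (auto simp: d_def)
  also have "\<dots> = card I" by (simp add: I_def card_PiE)
  finally have "card J < card I" .
  \<comment> \<open>The unknowns are the coefficients of the products; each m in J demands that the
    coefficient at m of the combination vanish.\<close>
  then obtain q where q: "\<exists>e\<in>I. q e \<noteq> 0"
    "\<And>m. m \<in> J \<Longrightarrow> (\<Sum>e\<in>I. q e * Poly_Mapping.lookup (\<Prod>i<l. a i ^ e i) m) = 0"
    using homogeneous_system_nontrivial_solution[OF J(1) finI,
        of "\<lambda>e. Poly_Mapping.lookup (\<Prod>i<l. a i ^ e i)"] by blast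
  define A where "A = {e \<in> I. q e \<noteq> 0}"
  define s where "s = (\<Sum>e\<in>A. Poly_Mapping.single 0 (q e) * (\<Prod>i<l. a i ^ e i))"
  have s: "Poly_Mapping.lookup s m = (\<Sum>e\<in>I. q e * Poly_Mapping.lookup (\<Prod>i<l. a i ^ e i) m)" for m
    unfolding s_def lookup_sum lookup_single_zero_mult
    using finI by (intro sum.mono_neutral_left) (auto simp: A_def)
  have deg: "exponents_le (l * (N * D)) (\<Prod>i<l. a i ^ e i)" if "e \<in> I" for e
  proof -
    have "exponents_le (\<Sum>i<l. N * D) (\<Prod>i<l. a i ^ e i)"
    proof (intro exponents_le_prod)
      fix i assume "i \<in> {..<l}"
      then have "exponents_le (e i * D) (a i ^ e i)" "e i * D \<le> N * D"
        using D that by (auto simp: I_def intro!: exponents_le_power)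
      then show "exponents_le (N * D) (a i ^ e i)" by (rule exponents_le_mono)
    qed
    then show ?thesis by simp
  qed
  have carr: "(\<Prod>i<l. a i ^ e i) \<in> carrier (poly_ring V)" for e
    using assms(2) by (intro poly_ring_prod_power_closed) auto
  have "s \<in> variable_prime V W"
    unfolding variable_prime_def
  proof (intro CollectI ballI)
    fix m assume m: "m \<in> Poly_Mapping.keys s"
    then have ne: "(\<Sum>e\<in>I. q e * Poly_Mapping.lookup (\<Prod>i<l. a i ^ e i) m) \<noteq> 0"
      using s by (simp add: in_keys_iff)
    then obtain e where e: "e \<in> I" "q e * Poly_Mapping.lookup (\<Prod>i<l. a i ^ e i) m \<noteq> 0"
      by (meson sum.neutral)
    then have mk: "m \<in> Poly_Mapping.keys (\<Prod>i<l. a i ^ e i)" by (auto simp: in_keys_iff)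
    then have "Poly_Mapping.keys m \<subseteq> V" "\<forall>v. Poly_Mapping.lookup m v \<le> l * (N * D)"
      using carr deg[OF e(1)] by (auto simp: carrier_poly_ring_iff exponents_le_def)
    moreover have "m \<notin> J" using ne q(2) by blast
    ultimately show "Poly_Mapping.keys m \<subseteq> V \<and> Poly_Mapping.keys m \<inter> W \<noteq> {}"
      by (auto simp: J_def)
  qed
  moreover have "finite A" "A \<noteq> {}" using finI q(1) by (auto simp: A_def)
  moreover have "A \<subseteq> extensional {..<l}" by (auto simp: A_def I_def PiE_def)
  moreover have "\<forall>e\<in>A. q e \<noteq> 0" by (simp add: A_def)
  ultimately show ?thesis unfolding s_def by blast
qed

section \<open>Strict chains of primes and algebraic relations\<close>

lemma primeideal_poly_ring_mult:
  assumes "primeideal P (poly_ring V :: ('v, 'k::field) mpoly ring)"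
    and "p \<in> carrier (poly_ring V)" "q \<in> carrier (poly_ring V)" "p * q \<in> P"
  shows "p \<in> P \<or> q \<in> P"
  using primeideal.I_prime[OF assms(1-3)] assms(4) by simp

lemma ideal_poly_ring_mult:
  assumes "ideal P (poly_ring V :: ('v, 'k::field) mpoly ring)"
    and "p \<in> carrier (poly_ring V)" "q \<in> P"
  shows "p * q \<in> P"
  using ideal.I_l_closed[OF assms(1) assms(3) assms(2)] by simp

lemma primeideal_poly_ring_power_mult:
  assumes "primeideal P (poly_ring V :: ('v, 'k::field) mpoly ring)"
    and "p \<in> carrier (poly_ring V)" "q \<in> carrier (poly_ring V)" "p \<notin> P" "p ^ n * q \<in> P"
  shows "q \<in> P"
  using assms(5)
proof (induction n)
  case (Suc n)
  have "p ^ n \<in> carrier (poly_ring V)" using assms(2) by (rule poly_ring_power_closed)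
  then have "p ^ n * q \<in> carrier (poly_ring V)" by (intro poly_ring_mult_closed assms)
  then show ?case using primeideal_poly_ring_mult[OF assms(1,2)] assms(4) Suc by (simp add: mult.assoc)
qed simp

lemma proper_ideal_no_constants:
  assumes "ideal P (poly_ring V :: ('v, 'k::field) mpoly ring)" "P \<noteq> carrier (poly_ring V)"
    and "Poly_Mapping.single 0 c \<in> P"
  shows "c = 0"
proof (rule ccontr)
  interpret ideal P "poly_ring V :: ('v, 'k) mpoly ring" by fact
  assume "c \<noteq> 0"
  then have "Poly_Mapping.single 0 (inverse c) * Poly_Mapping.single 0 c = (1 :: ('v, 'k) mpoly)"
    by (simp add: mult_single)
  then have "1 \<in> P"
    using ideal_poly_ring_mult[OF assms(1) _ assms(3), of "Poly_Mapping.single 0 (inverse c)"]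
    by (simp add: carrier_poly_ring_iff)
  then show False using assms(2) one_imp_carrier by simp
qed

text \<open>The elements \<open>a i\<close> of \<open>c (Suc i) - c i\<close> satisfy no algebraic relation modulo \<open>c 0\<close>:
  divide the relation by the least power of \<open>a j\<close> occurring in it, and reduce modulo
  \<open>c (Suc j)\<close>.\<close>

lemma prime_chain_no_relation:
  fixes a :: "nat \<Rightarrow> ('v, 'k::field) mpoly"
  assumes prime: "\<And>i. i \<le> l \<Longrightarrow> primeideal (c i) (poly_ring V)"
    and a: "\<And>i. i < l \<Longrightarrow> a i \<in> carrier (poly_ring V) \<and> a i \<in> c (Suc i) \<and> a i \<notin> c i"
    and chain: "\<And>i. i < l \<Longrightarrow> c i \<subseteq> c (Suc i)"
    and "j \<le> l" "finite A" "A \<noteq> {}" "\<And>e. e \<in> A \<Longrightarrow> q e \<noteq> 0"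
    and "\<And>e e'. e \<in> A \<Longrightarrow> e' \<in> A \<Longrightarrow> (\<And>i. j \<le> i \<Longrightarrow> i < l \<Longrightarrow> e i = e' i) \<Longrightarrow> e = e'"
  shows "(\<Sum>e\<in>A. Poly_Mapping.single 0 (q e) * (\<Prod>i\<in>{j..<l}. a i ^ e i)) \<notin> c j"
  using assms(4-)
proof (induction "l - j" arbitrary: j A)
  case 0
  then obtain e where e: "e \<in> A" by auto
  \<comment> \<open>For j = l there is no index left to tell exponent functions apart, so A is a
    singleton and the sum is a nonzero constant, which no proper ideal contains.\<close>
  have "e' = e" if "e' \<in> A" for e'
    using 0 by (intro 0(6)[OF that e]) auto
  then have A: "A = {e}" using e by blast
  have "ideal (c j) (poly_ring V)" "c j \<noteq> carrier (poly_ring V)"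
    using prime[of j] 0 by (auto simp: primeideal_def primeideal_axioms_def)
  then have "Poly_Mapping.single 0 (q e) \<notin> c j"
    using proper_ideal_no_constants[of "c j" V "q e"] 0(5) e by blast
  then show ?case using 0 A by simp
next
  case (Suc k)
  then have j: "j < l" by simp
  have carr: "(\<Prod>i\<in>X. a i ^ f i) \<in> carrier (poly_ring V)" if "X \<subseteq> {..<l}" for X f
    using that a by (intro poly_ring_prod_power_closed) auto
  have const: "Poly_Mapping.single 0 x \<in> carrier (poly_ring V)" for x :: 'k
    by (simp add: carrier_poly_ring_iff)
  have idl: "ideal (c i) (poly_ring V)" if "i \<le> l" for i
    using prime[OF that] by (simp add: primeideal_def)
  define r where "r = Min ((\<lambda>e. e j) ` A)"
  have r: "r \<le> e j" if "e \<in> A" for e using that Suc.prems by (simp add: r_def)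
  \<comment> \<open>These are the terms that survive modulo \<open>c (Suc j)\<close> after division
    by \<open>a j ^ r\<close>; all others keep a factor \<open>a j\<close>.\<close>
  define A' where "A' = {e \<in> A. e j = r}"
  have "r \<in> (\<lambda>e. e j) ` A" unfolding r_def using Suc.prems by (intro Min_in) auto
  then have A': "A' \<noteq> {}" "A' \<subseteq> A" "finite A'" using Suc.prems by (auto simp: A'_def)
  let ?t = "\<lambda>e. Poly_Mapping.single 0 (q e) * (\<Prod>i\<in>{Suc j..<l}. a i ^ e i)"
  have t: "?t e \<in> carrier (poly_ring V)" for e by (intro poly_ring_mult_closed const carr) auto
  define X where "X = (\<Sum>e\<in>A. a j ^ (e j - r) * ?t e)"
  have fac: "(\<Sum>e\<in>A. Poly_Mapping.single 0 (q e) * (\<Prod>i\<in>{j..<l}. a i ^ e i)) = a j ^ r * X"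
    unfolding X_def sum_distrib_left
  proof (rule sum.cong)
    fix e assume "e \<in> A"
    then have "a j ^ e j = a j ^ r * a j ^ (e j - r)" using r by (simp flip: power_add)
    moreover have "(\<Prod>i\<in>{j..<l}. a i ^ e i) = a j ^ e j * (\<Prod>i\<in>{Suc j..<l}. a i ^ e i)"
      using j by (rule prod.atLeast_Suc_lessThan)
    ultimately show "Poly_Mapping.single 0 (q e) * (\<Prod>i\<in>{j..<l}. a i ^ e i) = a j ^ r * (a j ^ (e j - r) * ?t e)"
      by (simp add: ac_simps)
  qed simp
  have aj: "a j ^ n \<in> carrier (poly_ring V)" for n using carr[of "{j}" "\<lambda>_. n"] j by simp
  have summand: "a j ^ (e j - r) * ?t e \<in> carrier (poly_ring V)" for e
    by (intro poly_ring_mult_closed aj t)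
  have high: "(\<Sum>e\<in>A - A'. a j ^ (e j - r) * ?t e) \<in> c (Suc j)"
  proof (rule ideal_poly_ring_sum[OF idl])
    fix e assume e: "e \<in> A - A'"
    then obtain n where n: "e j - r = Suc n" using r[of e] by (cases "e j - r") (auto simp: A'_def)
    have "a j ^ n * ?t e * a j \<in> c (Suc j)"
      using a[OF j] j by (intro ideal_poly_ring_mult[OF idl] poly_ring_mult_closed aj t) auto
    then show "a j ^ (e j - r) * ?t e \<in> c (Suc j)" by (simp add: n ac_simps)
  qed (use j in simp)
  have low: "(\<Sum>e\<in>A'. a j ^ (e j - r) * ?t e) = (\<Sum>e\<in>A'. ?t e)"
    by (intro sum.cong) (auto simp: A'_def)
  have X: "X = (\<Sum>e\<in>A - A'. a j ^ (e j - r) * ?t e) + (\<Sum>e\<in>A'. ?t e)"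
    unfolding X_def low[symmetric] using A' Suc.prems by (intro sum.subset_diff) auto
  have Xcarr: "X \<in> carrier (poly_ring V)"
  proof -
    interpret cring "poly_ring V :: ('v, 'k) mpoly ring" by (rule cring_poly_ring)
    show ?thesis unfolding X_def
      by (rule ideal_poly_ring_sum[OF oneideal summand])
  qed
  \<comment> \<open>The elements of A' agree at j, so they are still told apart by their values from
    \<open>Suc j\<close> on, as the induction hypothesis requires.\<close>
  have notin: "(\<Sum>e\<in>A'. ?t e) \<notin> c (Suc j)"
  proof (rule Suc.hyps(1))
    show "k = l - Suc j" using Suc.hyps by simp
    show "e = e'" if "e \<in> A'" "e' \<in> A'" "\<And>i. Suc j \<le> i \<Longrightarrow> i < l \<Longrightarrow> e i = e' i" for e e'
    proof (rule Suc.prems(5))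
      fix i assume "j \<le> i" "i < l"
      then show "e i = e' i" using that by (cases "i = j") (auto simp: A'_def)
    qed (use that A' in auto)
  qed (use j A' Suc.prems in auto)
  show ?case
  proof
    assume "(\<Sum>e\<in>A. Poly_Mapping.single 0 (q e) * (\<Prod>i\<in>{j..<l}. a i ^ e i)) \<in> c j"
    \<comment> \<open>The factor \<open>a j ^ r\<close> can be cancelled because c j is prime and
      does not contain \<open>a j\<close>.\<close>
    then have "X \<in> c j"
      unfolding fac using a[OF j] j prime[of j] Xcarr
      by (intro primeideal_poly_ring_power_mult[of "c j" V "a j" X r]) auto
    then have "X \<in> c (Suc j)" using chain j by blast
    then have "X - (\<Sum>e\<in>A - A'. a j ^ (e j - r) * ?t e) \<in> c (Suc j)"
      using high j by (intro ideal_poly_ring_diff[OF idl]) auto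
    then show False using notin X by simp
  qed
qed

text \<open>This plays the role of the dimension of the polynomial ring modulo the variables in W.
  It is applied with W the set of variables in the bottom prime for the quotient, and with W empty
  for chains in the whole ring.\<close>

lemma prime_chain_length_le:
  fixes c :: "nat \<Rightarrow> ('v, 'k::field) mpoly set"
  assumes "finite V" "W \<subseteq> V"
    and prime: "\<And>i. i \<le> l \<Longrightarrow> primeideal (c i) (poly_ring V)"
    and chain: "\<And>i. i < l \<Longrightarrow> c i \<subset> c (Suc i)"
    and W: "var ` W \<subseteq> c 0"
  shows "l \<le> card (V - W)"
proof (rule ccontr)
  assume less: "\<not> l \<le> card (V - W)"
  have "\<exists>x. x \<in> c (Suc i) \<and> x \<notin> c i" if "i < l" for i using chain[OF that] by blast
  then obtain a where a: "\<And>i. i < l \<Longrightarrow> a i \<in> c (Suc i) \<and> a i \<notin> c i" by metis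
  have idl: "ideal (c i) (poly_ring V)" if "i \<le> l" for i
    using prime[OF that] by (simp add: primeideal_def)
  have carr: "a i \<in> carrier (poly_ring V)" if "i < l" for i
    using ideal.Icarr[OF idl[of "Suc i"] conjunct1[OF a[OF that]]] that by simp
  have "card (V - W) < l" using less by simp
  with algebraic_relation_mod_variable_prime[OF assms(1), of l a W] carr
  obtain A :: "(nat \<Rightarrow> nat) set" and q where A: "finite A" "A \<noteq> {}" "\<forall>e\<in>A. q e \<noteq> 0" "A \<subseteq> extensional {..<l}"
    "(\<Sum>e\<in>A. Poly_Mapping.single 0 (q e) * (\<Prod>i<l. a i ^ e i)) \<in> variable_prime V W"
    by auto
  have "(\<Sum>e\<in>A. Poly_Mapping.single 0 (q e) * (\<Prod>i\<in>{0..<l}. a i ^ e i)) \<notin> c 0"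
  proof (rule prime_chain_no_relation)
    show "e = e'" if "e \<in> A" "e' \<in> A" "\<And>i. 0 \<le> i \<Longrightarrow> i < l \<Longrightarrow> e i = e' i" for e e'
      using that A(4) by (intro extensionalityI[of e "{..<l}"]) auto
  qed (use prime a carr psubset_imp_subset[OF chain] A in auto)
  moreover have "variable_prime V W \<subseteq> c 0"
    using idl W assms(2) by (intro variable_prime_subset_ideal) auto
  ultimately show False using A(5) by (auto simp: atLeast0LessThan)
qed

section \<open>Heights\<close>

lemma ideal_subset_carrier: "ideal I R \<Longrightarrow> I \<subseteq> carrier R"
  using additive_subgroup.a_subset ideal.axioms(1) by blast

section \<open>Primes of a quotient ring and primes containing the ideal\<close>

context cring
begin

lemma carrier_quotient_iff: "X \<in> carrier (R Quot I) \<longleftrightarrow> (\<exists>x\<in>carrier R. X = I +> x)"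
  by (auto simp: FactRing_def A_RCOSETS_def')

lemma quotient_image_mem_iff:
  assumes "ideal I R" "ideal P R" "I \<subseteq> P" "x \<in> carrier R"
  shows "I +> x \<in> (+>) I ` P \<longleftrightarrow> x \<in> P"
proof
  assume "I +> x \<in> (+>) I ` P"
  then obtain p where p: "p \<in> P" "I +> x = I +> p" by blast
  have pc: "p \<in> carrier R" using ideal.Icarr[OF assms(2) p(1)] .
  then have "x \<ominus> p \<in> P"
    using quotient_eq_iff_same_a_r_cos[OF assms(1,4) pc] p(2) assms(3) by blast
  then have "(x \<ominus> p) \<oplus> p \<in> P"
    using p(1) assms(2) by (simp add: additive_subgroup.a_closed ideal_def)
  moreover have "(x \<ominus> p) \<oplus> p = x" using assms(4) pc by algebra
  ultimately show "x \<in> P" by simp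
qed blast

lemma quotient_mult:
  assumes "ideal I R" "x \<in> carrier R" "y \<in> carrier R"
  shows "(I +> x) \<otimes>\<^bsub>R Quot I\<^esub> (I +> y) = I +> (x \<otimes> y)"
  using ring_hom_mult[OF ideal.rcos_ring_hom[OF assms(1)] assms(2,3)] by simp

text \<open>Elements of \<open>R Quot I\<close> are cosets, that is, subsets of R, so the union of a
  set of cosets is its preimage under the projection. Together with
  \<open>quotient_image_Union\<close> this makes image and union mutually inverse.\<close>

lemma Union_quotient_image:
  assumes "ideal I R" "ideal P R" "I \<subseteq> P"
  shows "\<Union>((+>) I ` P) = P"
  using ideal_incl_iff[OF assms(1,2)] assms(3) by simp

lemma quotient_image_Union:
  assumes "ideal I R" "J \<subseteq> carrier (R Quot I)"
  shows "(+>) I ` \<Union>J = J"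
proof -
  have mem: "a \<in> \<Union>J \<longleftrightarrow> I +> a \<in> J" if "a \<in> carrier R" for a
    using canonical_proj_vimage_mem_iff[OF assms that] .
  have sub: "\<Union>J \<subseteq> carrier R" using canonical_proj_vimage_in_carrier[OF assms] .
  show ?thesis
  proof
    show "(+>) I ` \<Union>J \<subseteq> J" using mem sub by blast
    show "J \<subseteq> (+>) I ` \<Union>J"
    proof
      fix X assume X: "X \<in> J"
      then obtain x where x: "x \<in> carrier R" "X = I +> x"
        using assms(2) carrier_quotient_iff by blast
      then have "x \<in> \<Union>J" using mem X by blast
      then show "X \<in> (+>) I ` \<Union>J" using x(2) by blast
    qed
  qed
qed

lemma subset_Union_quotient_ideal:
  assumes "ideal I R" "ideal J (R Quot I)"
  shows "I \<subseteq> \<Union>J"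
proof
  fix x assume x: "x \<in> I"
  then have xc: "x \<in> carrier R" using ideal_subset_carrier[OF assms(1)] by blast
  have "I +> x = I" using a_rcos_zero[OF assms(1) x] .
  moreover have "\<zero>\<^bsub>R Quot I\<^esub> \<in> J"
    using assms(2) by (simp add: additive_subgroup.zero_closed ideal_def)
  ultimately have "I +> x \<in> J" by (simp add: FactRing_def)
  moreover have "J \<subseteq> carrier (R Quot I)" using ideal_subset_carrier[OF assms(2)] .
  ultimately show "x \<in> \<Union>J" using canonical_proj_vimage_mem_iff[OF assms(1) _ xc] by blast
qed

lemma quotient_image_primeideal:
  assumes "ideal I R" "primeideal P R" "I \<subseteq> P"
  shows "primeideal ((+>) I ` P) (R Quot I)"
proof (rule primeidealI)
  have P: "ideal P R" using assms(2) by (simp add: primeideal_def)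
  note mem = quotient_image_mem_iff[OF assms(1) P assms(3)]
  show "ideal ((+>) I ` P) (R Quot I)" using ring_ideal_imp_quot_ideal[OF assms(1) P] .
  show "cring (R Quot I)" using ideal.quotient_is_cring[OF assms(1) is_cring] .
  have "P \<subseteq> carrier R" "carrier R \<noteq> P"
    using ideal_subset_carrier[OF P] primeideal.I_notcarr[OF assms(2)] by auto
  then obtain x where "x \<in> carrier R" "x \<notin> P" by blast
  then show "carrier (R Quot I) \<noteq> (+>) I ` P" using mem[of x] carrier_quotient_iff by blast
  fix X Y assume XY: "X \<in> carrier (R Quot I)" "Y \<in> carrier (R Quot I)"
    "X \<otimes>\<^bsub>R Quot I\<^esub> Y \<in> (+>) I ` P"
  then obtain x y where xy: "x \<in> carrier R" "X = I +> x" "y \<in> carrier R" "Y = I +> y"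
    unfolding carrier_quotient_iff by blast
  then have "x \<otimes> y \<in> P" using XY(3) mem[of "x \<otimes> y"] quotient_mult[OF assms(1)] by simp
  then have "x \<in> P \<or> y \<in> P" by (rule primeideal.I_prime[OF assms(2) xy(1,3)])
  then show "X \<in> (+>) I ` P \<or> Y \<in> (+>) I ` P" using xy(2,4) by auto
qed

lemma Union_quotient_primeideal:
  assumes "ideal I R" "primeideal Q (R Quot I)"
  shows "primeideal (\<Union>Q) R"
proof (rule primeidealI)
  have Q: "ideal Q (R Quot I)" using assms(2) by (simp add: primeideal_def)
  then have sub: "Q \<subseteq> carrier (R Quot I)" by (rule ideal_subset_carrier)
  note mem = canonical_proj_vimage_mem_iff[OF assms(1) sub]
  show "ideal (\<Union>Q) R" using quot_ideal_imp_ring_ideal[OF assms(1) Q] .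
  show "cring R" by (rule is_cring)
  obtain X where "X \<in> carrier (R Quot I)" "X \<notin> Q"
    using sub primeideal.I_notcarr[OF assms(2)] by blast
  then obtain x where "x \<in> carrier R" "I +> x \<notin> Q" unfolding carrier_quotient_iff by blast
  then show "carrier R \<noteq> \<Union>Q" using mem[of x] by auto
  fix x y assume xy: "x \<in> carrier R" "y \<in> carrier R" "x \<otimes> y \<in> \<Union>Q"
  then have "(I +> x) \<otimes>\<^bsub>R Quot I\<^esub> (I +> y) \<in> Q"
    using mem[of "x \<otimes> y"] quotient_mult[OF assms(1)] by simp
  then have "I +> x \<in> Q \<or> I +> y \<in> Q"
    using xy by (intro primeideal.I_prime[OF assms(2)]) (auto simp: carrier_quotient_iff)
  then show "x \<in> \<Union>Q \<or> y \<in> \<Union>Q" using mem[of x] mem[of y] xy by simp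
qed

text \<open>Image and union carry primes to primes and undo each other, so they also preserve
  strictness of inclusions. In an increasing chain it is enough to require I in the bottom
  member.\<close>

lemma prime_height_quotient:
  assumes I: "ideal I R" and P: "ideal P R" and IP: "I \<subseteq> P"
  shows "prime_height (R Quot I) ((+>) I ` P) =
    Sup {enat n | n. \<exists>c. (\<forall>i\<le>n. primeideal (c i) R) \<and> (\<forall>i<n. c i \<subset> c (Suc i)) \<and> I \<subseteq> c 0 \<and> c n = P}"
    (is "_ = Sup {enat n | n. \<exists>c. ?chain n c}")
proof -
  let ?qchain = "\<lambda>n c. (\<forall>i\<le>n. primeideal (c i) (R Quot I)) \<and> (\<forall>i<n. c i \<subset> c (Suc i)) \<and>
    c n = (+>) I ` P"
  have "(\<exists>c. ?qchain n c) \<longleftrightarrow> (\<exists>c. ?chain n c)" for n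
  proof
    assume "\<exists>c. ?qchain n c"
    then obtain c where c: "\<And>i. i \<le> n \<Longrightarrow> primeideal (c i) (R Quot I)"
      "\<And>i. i < n \<Longrightarrow> c i \<subset> c (Suc i)" "c n = (+>) I ` P" by blast
    have idl: "ideal (c i) (R Quot I)" if "i \<le> n" for i
      using c(1)[OF that] by (simp add: primeideal_def)
    have img: "(+>) I ` \<Union>(c i) = c i" if "i \<le> n" for i
      by (rule quotient_image_Union[OF I]) (rule ideal_subset_carrier[OF idl[OF that]])
    have "\<Union>(c i) \<subset> \<Union>(c (Suc i))" if "i < n" for i
    proof -
      have "\<Union>(c i) \<subseteq> \<Union>(c (Suc i))" by (rule Union_mono[OF psubset_imp_subset[OF c(2)[OF that]]])
      moreover have "\<Union>(c i) \<noteq> \<Union>(c (Suc i))"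
      proof
        assume "\<Union>(c i) = \<Union>(c (Suc i))"
        then have "(+>) I ` \<Union>(c i) = (+>) I ` \<Union>(c (Suc i))" by (rule arg_cong)
        moreover have "(+>) I ` \<Union>(c i) = c i" "(+>) I ` \<Union>(c (Suc i)) = c (Suc i)"
          using that by (simp_all only: img less_imp_le Suc_le_eq)
        ultimately have "c i = c (Suc i)" by metis
        then show False using c(2)[OF that] by simp
      qed
      ultimately show ?thesis by (rule psubsetI)
    qed
    moreover have "I \<subseteq> \<Union>(c 0)" using subset_Union_quotient_ideal[OF I idl] by simp
    moreover have "\<Union>(c n) = P" using Union_quotient_image[OF I P IP] c(3) by simp
    ultimately show "\<exists>c. ?chain n c"
      using Union_quotient_primeideal[OF I c(1)] by (intro exI[of _ "\<lambda>i. \<Union>(c i)"]) blast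
  next
    assume "\<exists>c. ?chain n c"
    then obtain c where c: "\<And>i. i \<le> n \<Longrightarrow> primeideal (c i) R"
      "\<And>i. i < n \<Longrightarrow> c i \<subset> c (Suc i)" "I \<subseteq> c 0" "c n = P" by blast
    have Ic: "I \<subseteq> c i" if "i \<le> n" for i
      using that by (induction i) (use c(2,3) in \<open>auto simp: Suc_le_eq\<close>)
    have U: "\<Union>((+>) I ` c i) = c i" if "i \<le> n" for i
      using c(1)[OF that] Ic[OF that] by (intro Union_quotient_image[OF I]) (simp_all add: primeideal_def)
    have "(+>) I ` c i \<subset> (+>) I ` c (Suc i)" if "i < n" for i
    proof -
      have "(+>) I ` c i \<subseteq> (+>) I ` c (Suc i)" by (rule image_mono[OF psubset_imp_subset[OF c(2)[OF that]]])
      moreover have "(+>) I ` c i \<noteq> (+>) I ` c (Suc i)"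
      proof
        assume "(+>) I ` c i = (+>) I ` c (Suc i)"
        then have "\<Union>((+>) I ` c i) = \<Union>((+>) I ` c (Suc i))" by (rule arg_cong)
        moreover have "\<Union>((+>) I ` c i) = c i" "\<Union>((+>) I ` c (Suc i)) = c (Suc i)"
          using that by (simp_all only: U less_imp_le Suc_le_eq)
        ultimately have "c i = c (Suc i)" by metis
        then show False using c(2)[OF that] by simp
      qed
      ultimately show ?thesis by (rule psubsetI)
    qed
    then show "\<exists>c. ?qchain n c"
      using quotient_image_primeideal[OF I c(1) Ic] c(4)
      by (intro exI[of _ "\<lambda>i. (+>) I ` c i"]) auto
  qed
  then show ?thesis unfolding prime_height_def by simp
qed

lemma quotient_image_maximalideal:
  assumes I: "ideal I R" and P: "maximalideal P R" and IP: "I \<subseteq> P"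
  shows "maximalideal ((+>) I ` P) (R Quot I)"
proof (rule maximalidealI)
  have Pid: "ideal P R" using P by (simp add: maximalideal_def)
  show "ideal ((+>) I ` P) (R Quot I)" using ring_ideal_imp_quot_ideal[OF I Pid] .
  have "P \<subseteq> carrier R" "carrier R \<noteq> P"
    using ideal_subset_carrier[OF Pid] maximalideal.I_notcarr[OF P] by auto
  then obtain x where "x \<in> carrier R" "x \<notin> P" by blast
  then show "carrier (R Quot I) \<noteq> (+>) I ` P"
    using quotient_image_mem_iff[OF I Pid IP, of x] carrier_quotient_iff by blast
  fix J assume J: "ideal J (R Quot I)" "(+>) I ` P \<subseteq> J" "J \<subseteq> carrier (R Quot I)"
  have "ideal (\<Union>J) R" using quot_ideal_imp_ring_ideal[OF I J(1)] .
  moreover have "P \<subseteq> \<Union>J" using Union_quotient_image[OF I Pid IP] J(2) by blast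
  moreover have "\<Union>J \<subseteq> carrier R" using canonical_proj_vimage_in_carrier[OF I J(3)] .
  ultimately have "\<Union>J = P \<or> \<Union>J = carrier R" by (rule maximalideal.I_maximal[OF P])
  moreover have "(+>) I ` carrier R = carrier (R Quot I)" using carrier_quotient_iff by blast
  ultimately show "J = (+>) I ` P \<or> J = carrier (R Quot I)"
    using quotient_image_Union[OF I J(3)] by metis
qed

end

section \<open>Heights of monomial ideals\<close>

lemma variable_prime_mono: "C \<subseteq> D \<Longrightarrow> variable_prime V C \<subseteq> variable_prime V D"
  unfolding variable_prime_def by blast

lemma var_in_variable_prime_iff:
  "(var v :: ('v, 'k::field) mpoly) \<in> variable_prime V C \<longleftrightarrow> v \<in> V \<and> v \<in> C"
  by (auto simp: variable_prime_def var_def mon_def)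

text \<open>The variables of D - C are adjoined one at a time; every step is strict because the new
  variable is not in the ideal before.\<close>

lemma variable_prime_chain:
  assumes "finite V" "C \<subseteq> D" "D \<subseteq> V"
  shows "\<exists>c :: nat \<Rightarrow> ('v, 'k::field) mpoly set. (\<forall>i. primeideal (c i) (poly_ring V)) \<and>
    (\<forall>i<card (D - C). c i \<subset> c (Suc i)) \<and>
    c 0 = variable_prime V C \<and> c (card (D - C)) = variable_prime V D"
proof -
  let ?n = "card (D - C)"
  have fin: "finite (D - C)" using assms finite_subset by blast
  then obtain f where f: "bij_betw f {..<?n} (D - C)"
    using ex_bij_betw_nat_finite[OF fin] by (auto simp: atLeast0LessThan)
  define c :: "nat \<Rightarrow> ('v, 'k) mpoly set" where "c i = variable_prime V (C \<union> f ` {..<i})" for i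
  have "c i \<subset> c (Suc i)" if i: "i < ?n" for i
  proof -
    have "f i \<in> D - C" using f i by (auto simp: bij_betw_def)
    moreover have "f i \<notin> f ` {..<i}"
    proof
      assume "f i \<in> f ` {..<i}"
      then obtain j where "j < i" "f i = f j" by auto
      then show False using inj_onD[OF bij_betw_imp_inj_on[OF f], of i j] i by simp
    qed
    ultimately have "var (f i) \<notin> c i" "var (f i) \<in> c (Suc i)"
      using assms(3) unfolding c_def var_in_variable_prime_iff by auto
    moreover have "c i \<subseteq> c (Suc i)" unfolding c_def by (intro variable_prime_mono) auto
    ultimately show ?thesis by blast
  qed
  moreover have "c ?n = variable_prime V D"
    using f assms(2) unfolding c_def bij_betw_def by (simp add: Un_absorb1)
  moreover have "primeideal (c i) (poly_ring V)" for i
    unfolding c_def by (rule variable_prime_primeideal[OF assms(1)])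
  moreover have "c 0 = variable_prime V C" by (simp add: c_def)
  ultimately show ?thesis by blast
qed

lemma graded_maximal_ideal_eq: "graded_maximal_ideal V = variable_prime V V"
  unfolding graded_maximal_ideal_def by (rule variable_prime_genideal) simp

text \<open>An element p outside the ideal differs from its constant term c by an element of the
  ideal. So any larger ideal J contains c, which is zero if J is proper, and then p was in the ideal
  after all.\<close>

lemma graded_maximal_ideal_maximalideal:
  assumes "finite V"
  shows "maximalideal (variable_prime V V) (poly_ring V :: ('v, 'k::field) mpoly ring)"
proof (rule maximalidealI)
  have prime: "primeideal (variable_prime V V) (poly_ring V :: ('v, 'k) mpoly ring)"
    by (rule variable_prime_primeideal[OF assms])
  then show "ideal (variable_prime V V) (poly_ring V :: ('v, 'k) mpoly ring)"
    "carrier (poly_ring V :: ('v, 'k) mpoly ring) \<noteq> variable_prime V V"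
    by (auto simp: primeideal_def primeideal_axioms_def)
  fix J :: "('v, 'k) mpoly set"
  assume J: "ideal J (poly_ring V)" "variable_prime V V \<subseteq> J" "J \<subseteq> carrier (poly_ring V)"
  show "J = variable_prime V V \<or> J = carrier (poly_ring V)"
  proof (rule ccontr)
    assume neg: "\<not> ?thesis"
    then obtain p where p: "p \<in> J" "p \<notin> variable_prime V V" using J(2) by blast
    define c where "c = Poly_Mapping.lookup p 0"
    let ?q = "p - Poly_Mapping.single 0 c"
    have pV: "p \<in> carrier (poly_ring V)" using p J(3) by blast
    have "?q \<in> variable_prime V V"
      unfolding variable_prime_def
    proof (intro CollectI ballI)
      fix m assume m: "m \<in> Poly_Mapping.keys ?q"
      then have "m \<noteq> 0" by (auto simp: in_keys_iff lookup_minus c_def)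
      then have "m \<in> Poly_Mapping.keys p" using m by (auto simp: in_keys_iff lookup_minus lookup_single)
      then have "Poly_Mapping.keys m \<subseteq> V" using pV by (simp add: carrier_poly_ring_iff)
      moreover have "Poly_Mapping.keys m \<noteq> {}" using \<open>m \<noteq> 0\<close> by simp
      ultimately show "Poly_Mapping.keys m \<subseteq> V \<and> Poly_Mapping.keys m \<inter> V \<noteq> {}" by blast
    qed
    moreover from this have "Poly_Mapping.single 0 c \<in> J"
      using ideal_poly_ring_diff[OF J(1) p(1), of ?q] J(2) by auto
    then have "c = 0" using proper_ideal_no_constants[OF J(1)] neg by blast
    ultimately show False using p(2) by simp
  qed
qed

text \<open>Split off one variable and use primality; the total degree drops. The exponent 0 is
  excluded since it would put 1 into P.\<close>

lemma prime_contains_variable_of_monomial: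
  assumes "primeideal P (poly_ring V :: ('v, 'k::field) mpoly ring)" "finite V"
    and "Poly_Mapping.keys b \<subseteq> V" "mon b \<in> P"
  shows "\<exists>v\<in>Poly_Mapping.keys b. var v \<in> P"
  using assms(3,4)
proof (induction "\<Sum>v\<in>V. Poly_Mapping.lookup b v" arbitrary: b rule: less_induct)
  case (less b)
  show ?case
  proof (cases "b = 0")
    case True
    then have "Poly_Mapping.single 0 1 \<in> P" using less by (simp add: mon_def)
    then have "(1 :: 'k) = 0"
      using assms(1) by (intro proper_ideal_no_constants[of P V]) (auto simp: primeideal_def primeideal_axioms_def)
    then show ?thesis by simp
  next
    case False
    then obtain v where v: "v \<in> Poly_Mapping.keys b" by fastforce
    from expo_split_variable[OF this] obtain c where c: "b = Poly_Mapping.single v 1 + c" by auto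
    then have keys: "Poly_Mapping.keys c \<subseteq> Poly_Mapping.keys b" by (auto simp: keys_add_expo)
    have "mon b = (var v * mon c :: ('v, 'k) mpoly)" by (simp add: var_def mon_def mult_single c)
    moreover have "var v \<in> carrier (poly_ring V :: ('v, 'k) mpoly ring)"
      "mon c \<in> carrier (poly_ring V :: ('v, 'k) mpoly ring)"
      using v less.prems keys by (auto simp: var_def mon_def carrier_poly_ring_iff)
    ultimately have "var v \<in> P \<or> mon c \<in> P"
      using primeideal_poly_ring_mult[OF assms(1)] less.prems by metis
    then show ?thesis
    proof
      assume "mon c \<in> P"
      moreover have "(\<Sum>v\<in>V. Poly_Mapping.lookup c v) < (\<Sum>v\<in>V. Poly_Mapping.lookup b v)"
        using assms(2) v less.prems
        by (intro sum_strict_mono_ex1 bexI[of _ v]) (auto simp: c lookup_add)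
      ultimately show ?thesis using less.hyps[of c] keys less.prems by blast
    qed (use v in blast)
  qed
qed

lemma monomial_ideal_subset_variable_prime:
  assumes "\<And>b. b \<in> B \<Longrightarrow> Poly_Mapping.keys b \<inter> C \<noteq> {}"
  shows "monomial_ideal V B \<subseteq> variable_prime V C"
proof
  fix p assume p: "p \<in> monomial_ideal V B"
  show "p \<in> variable_prime V C"
    unfolding variable_prime_def
  proof (intro CollectI ballI)
    fix m assume "m \<in> Poly_Mapping.keys p"
    then obtain b c where "b \<in> B" "m = b + c" "Poly_Mapping.keys m \<subseteq> V"
      using p unfolding monomial_ideal_def by blast
    then show "Poly_Mapping.keys m \<subseteq> V \<and> Poly_Mapping.keys m \<inter> C \<noteq> {}"
      using assms[of b] by (auto simp: keys_add_expo)
  qed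
qed

text \<open>The set C meets the supports of all generators and has least cardinality among such
  sets, so it is more than inclusion-minimal: \<open>card C\<close> is the height of the
  ideal.\<close>

context
  fixes V :: "'v set" and B :: "'v expo set" and C :: "'v set"
  assumes V: "finite V" and B: "\<And>b. b \<in> B \<Longrightarrow> Poly_Mapping.keys b \<subseteq> V"
    and C: "C \<subseteq> V" "\<And>b. b \<in> B \<Longrightarrow> Poly_Mapping.keys b \<inter> C \<noteq> {}"
    and C_min: "\<And>D. D \<subseteq> V \<Longrightarrow> (\<And>b. b \<in> B \<Longrightarrow> Poly_Mapping.keys b \<inter> D \<noteq> {}) \<Longrightarrow> card C \<le> card D"
begin

text \<open>Each generator forces one of its variables into P, so the variables in P meet all
  supports and compete with C.\<close>

lemma card_variables_in_prime_ge:
  assumes "primeideal P (poly_ring V :: ('v, 'k::field) mpoly ring)" "monomial_ideal V B \<subseteq> P"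
  shows "card C \<le> card {v \<in> V. var v \<in> P}"
proof (rule C_min)
  fix b assume b: "b \<in> B"
  then have "mon b \<in> P"
    using assms(2) B mon_in_monomial_ideal_iff[of b V B] by (metis add.right_neutral subsetD)
  then show "Poly_Mapping.keys b \<inter> {v \<in> V. var v \<in> P} \<noteq> {}"
    using prime_contains_variable_of_monomial[OF assms(1) V B[OF b]] B[OF b] by blast
qed blast

text \<open>A chain above I starts at a prime with at least \<open>card C\<close> variables, so the
  chain bound leaves at most \<open>card V - card C\<close> steps. Adjoining the variables outside C
  to \<open>variable_prime V C\<close> attains this.\<close>

lemma prime_height_quotient_monomial_ideal:
  fixes I :: "('v, 'k::field) mpoly set"
  assumes "I = monomial_ideal V B"
  shows "prime_height (poly_ring V Quot I) ((+>\<^bsub>poly_ring V\<^esub>) I ` variable_prime V V) = enat (card V - card C)"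
proof -
  interpret cring "poly_ring V :: ('v, 'k) mpoly ring" by (rule cring_poly_ring)
  have I: "ideal I (poly_ring V)" unfolding assms by (rule monomial_ideal_is_ideal)
  have IC: "I \<subseteq> variable_prime V C"
    unfolding assms using C by (intro monomial_ideal_subset_variable_prime)
  have m: "ideal (variable_prime V V) (poly_ring V :: ('v, 'k) mpoly ring)"
    using maximalideal.axioms(1)[OF graded_maximal_ideal_maximalideal[OF V]] .
  have Im: "I \<subseteq> variable_prime V V" using IC variable_prime_mono[OF C(1)] by blast
  show ?thesis
    unfolding prime_height_quotient[OF I m Im]
  proof (rule antisym)
    show "Sup {enat n | n. \<exists>c. (\<forall>i\<le>n. primeideal (c i) (poly_ring V)) \<and> (\<forall>i<n. c i \<subset> c (Suc i)) \<and>
        I \<subseteq> c 0 \<and> c n = variable_prime V V} \<le> enat (card V - card C)"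
    proof (rule Sup_least, clarify)
      fix n and c :: "nat \<Rightarrow> ('v, 'k) mpoly set"
      assume c: "\<forall>i\<le>n. primeideal (c i) (poly_ring V)" "\<forall>i<n. c i \<subset> c (Suc i)" "I \<subseteq> c 0"
      let ?W = "{v \<in> V. var v \<in> c 0}"
      have "n \<le> card (V - ?W)"
        using c(1,2) by (intro prime_chain_length_le[OF V, where c = c]) (blast | simp)+
      also have "\<dots> = card V - card ?W" using V by (intro card_Diff_subset) auto
      also have "\<dots> \<le> card V - card C"
        using card_variables_in_prime_ge[of "c 0"] c assms by (intro diff_le_mono2) auto
      finally show "enat n \<le> enat (card V - card C)" by simp
    qed
    obtain c :: "nat \<Rightarrow> ('v, 'k) mpoly set" where c: "\<forall>i. primeideal (c i) (poly_ring V)"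
      "\<forall>i<card (V - C). c i \<subset> c (Suc i)"
      "c 0 = variable_prime V C" "c (card (V - C)) = variable_prime V V"
      using variable_prime_chain[OF V C(1) subset_refl] by blast
    have "card (V - C) = card V - card C" using V C(1) by (intro card_Diff_subset finite_subset[OF C(1)])
    then show "enat (card V - card C) \<le> Sup {enat n | n. \<exists>c. (\<forall>i\<le>n. primeideal (c i) (poly_ring V)) \<and>
        (\<forall>i<n. c i \<subset> c (Suc i)) \<and> I \<subseteq> c 0 \<and> c n = variable_prime V V}"
      using c IC by (intro Sup_upper CollectI exI[of _ "card V - card C"] conjI exI[of _ c]) auto
  qed
qed

text \<open>Above: a chain ending in \<open>variable_prime V C\<close> can be continued by
  \<open>card V - card C\<close> steps to the graded maximal ideal, and the total is at most
  \<open>card V\<close>. Below: every prime over I contains at least \<open>card C\<close> variables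
  and hence sits on top of a chain of that length.\<close>

lemma ideal_height_monomial_ideal:
  fixes I :: "('v, 'k::field) mpoly set"
  assumes "I = monomial_ideal V B"
  shows "ideal_height (poly_ring V) I = enat (card C)"
proof (rule antisym)
  have IC: "I \<subseteq> variable_prime V C"
    unfolding assms using C by (intro monomial_ideal_subset_variable_prime)
  have fC: "finite C" using finite_subset[OF C(1) V] .
  have "prime_height (poly_ring V) (variable_prime V C :: ('v, 'k) mpoly set) \<le> enat (card C)"
    unfolding prime_height_def
  proof (rule Sup_least, clarify)
    fix n and c :: "nat \<Rightarrow> ('v, 'k) mpoly set"
    assume c: "\<forall>i\<le>n. primeideal (c i) (poly_ring V)" "\<forall>i<n. c i \<subset> c (Suc i)"
      "c n = variable_prime V C"
    obtain d :: "nat \<Rightarrow> ('v, 'k) mpoly set" where d: "\<forall>i. primeideal (d i) (poly_ring V)"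
      "\<forall>i<card (V - C). d i \<subset> d (Suc i)"
      "d 0 = variable_prime V C" "d (card (V - C)) = variable_prime V V"
      using variable_prime_chain[OF V C(1) subset_refl] by blast
    define e where "e i = (if i \<le> n then c i else d (i - n))" for i
    have "n + card (V - C) \<le> card (V - {})"
    proof (rule prime_chain_length_le[OF V])
      show "primeideal (e i) (poly_ring V)" for i using c d by (simp add: e_def)
      show "e i \<subset> e (Suc i)" if "i < n + card (V - C)" for i
      proof (cases "i < n")
        case True
        then show ?thesis using c by (simp add: e_def)
      next
        case False
        then have "e i = d (i - n)" using c d by (auto simp: e_def)
        moreover have "e (Suc i) = d (Suc (i - n))" using False by (simp add: e_def Suc_diff_le)
        moreover have "i - n < card (V - C)" using False that by linarith
        ultimately show ?thesis using d(2) by simp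
      qed
    qed auto
    moreover have "card (V - C) = card V - card C" "card C \<le> card V"
      using V C(1) fC by (auto intro: card_Diff_subset card_mono)
    ultimately show "enat n \<le> enat (card C)" by simp
  qed
  moreover have "ideal_height (poly_ring V) I \<le>
      prime_height (poly_ring V) (variable_prime V C :: ('v, 'k) mpoly set)"
    unfolding ideal_height_def using IC variable_prime_primeideal[OF V]
    by (intro Inf_lower CollectI exI[of _ "variable_prime V C"]) auto
  ultimately show "ideal_height (poly_ring V) I \<le> enat (card C)" by (rule order_trans[rotated])
  show "enat (card C) \<le> ideal_height (poly_ring V) I"
    unfolding ideal_height_def
  proof (rule Inf_greatest, clarify)
    fix P assume P: "primeideal P (poly_ring V :: ('v, 'k) mpoly ring)" "I \<subseteq> P"
    define D where "D = {v \<in> V. var v \<in> P}"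
    have le: "card C \<le> card D" unfolding D_def using card_variables_in_prime_ge[OF P(1)] P(2) assms by simp
    have DP: "variable_prime V D \<subseteq> P"
      using P(1) by (intro variable_prime_subset_ideal) (auto simp: D_def primeideal_def)
    have DV: "D \<subseteq> V" by (auto simp: D_def)
    obtain d :: "nat \<Rightarrow> ('v, 'k) mpoly set" where d: "\<forall>i. primeideal (d i) (poly_ring V)"
      "\<forall>i<card (D - {}). d i \<subset> d (Suc i)" "d (card (D - {})) = variable_prime V D"
      using variable_prime_chain[OF V empty_subsetI DV] by blast
    \<comment> \<open>P replaces the last member of the chain instead of following it, since P may
      coincide with \<open>variable_prime V D\<close>.\<close>
    define e where "e i = (if i < card D then d i else P)" for i
    have "e i \<subset> e (Suc i)" if i: "i < card D" for i
    proof (cases "Suc i = card D")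
      case True
      moreover have "d i \<subset> d (Suc i)" using d(2) i by simp
      ultimately show ?thesis using d(3) DP i by (simp add: e_def psubset_subset_trans)
    next
      case False
      then show ?thesis using d(2) i by (simp add: e_def)
    qed
    then have "\<exists>c. (\<forall>i\<le>card D. primeideal (c i) (poly_ring V)) \<and> (\<forall>i<card D. c i \<subset> c (Suc i)) \<and> c (card D) = P"
      using d(1) P(1) by (intro exI[of _ e]) (auto simp: e_def)
    then have "enat (card D) \<le> prime_height (poly_ring V) P"
      unfolding prime_height_def by (intro Sup_upper) blast
    then show "enat (card C) \<le> prime_height (poly_ring V) P" using le by (meson enat_ord_simps(1) order_trans)
  qed
qed

end

section \<open>Matching powers of edge ideals\<close>

definition squarefree_expo :: "'v set \<Rightarrow> 'v expo" where
  "squarefree_expo A = (\<Sum>v\<in>A. Poly_Mapping.single v 1)"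

lemma lookup_squarefree_expo:
  assumes "finite A"
  shows "Poly_Mapping.lookup (squarefree_expo A) v = (if v \<in> A then 1 else 0)"
proof -
  have "Poly_Mapping.lookup (squarefree_expo A) v = (\<Sum>w\<in>A. if w = v then 1 else 0)"
    unfolding squarefree_expo_def lookup_sum
    by (intro sum.cong) (auto simp: lookup_single when_def)
  then show ?thesis using assms by simp
qed

lemma keys_squarefree_expo: "finite A \<Longrightarrow> Poly_Mapping.keys (squarefree_expo A) = A"
  by (auto simp: in_keys_iff lookup_squarefree_expo split: if_splits)

lemma squarefree_expo_divides:
  assumes "finite A" "finite B" "squarefree_expo A = squarefree_expo B + c"
  shows "B \<subseteq> A"
  using keys_add_expo[of "squarefree_expo B" c] assms(1,2)
  by (simp add: keys_squarefree_expo flip: assms(3))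

lemma prod_mon: "(\<Prod>i\<in>A. mon (u i)) = mon (\<Sum>i\<in>A. u i)"
  by (induction A rule: infinite_finite_induct) (simp_all add: mon_def mult_single)

text \<open>For an irredundant generating set A, each b in B is a multiple of some a in A, which is
  a multiple of some b' in B. The antichain condition gives b = b', so both quotients are trivial
  and b = a. Hence A contains B, and minimality of A gives equality.\<close>

lemma min_monomial_gens_eq:
  assumes "\<And>b. b \<in> B \<Longrightarrow> Poly_Mapping.keys b \<subseteq> V"
    and antichain: "\<And>b b' c. b \<in> B \<Longrightarrow> b' \<in> B \<Longrightarrow> b = b' + c \<Longrightarrow> b = b'"
  shows "min_monomial_gens V (monomial_ideal V B :: ('v, 'k::field) mpoly set) = B"
  unfolding min_monomial_gens_def
proof (rule the_equality)
  let ?I = "monomial_ideal V B :: ('v, 'k) mpoly set"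
  have gen: "generated_by_monomials V ?I A \<longleftrightarrow>
      (\<forall>m\<in>A. Poly_Mapping.keys m \<subseteq> V) \<and> ?I = monomial_ideal V A" for A
    unfolding generated_by_monomials_def using genideal_monomials[of A V] by metis
  have B: "generated_by_monomials V ?I B" using assms(1) by (simp add: gen)
  have divisor: "\<exists>a\<in>A. \<exists>c. b = a + c"
    if "?I = monomial_ideal V A" "Poly_Mapping.keys b \<subseteq> V" "\<exists>b'\<in>B. \<exists>c. b = b' + c" for A b
  proof -
    have "mon b \<in> ?I" using that(2,3) by (simp add: mon_in_monomial_ideal_iff)
    then show ?thesis unfolding that(1) by (simp add: mon_in_monomial_ideal_iff)
  qed
  have "\<not> generated_by_monomials V ?I B'" if B': "B' \<subset> B" for B'
  proof
    assume "generated_by_monomials V ?I B'"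
    then have eq: "?I = monomial_ideal V B'" by (simp add: gen)
    obtain b where b: "b \<in> B" "b \<notin> B'" using B' by blast
    have "\<exists>a\<in>B'. \<exists>c. b = a + c"
      using b by (intro divisor[OF eq assms(1)] bexI[of _ b] exI[of _ 0]) auto
    then obtain a c where "a \<in> B'" "b = a + c" by blast
    then have "b = a" using antichain[of b a c] b(1) B' by blast
    then show False using \<open>a \<in> B'\<close> b(2) by simp
  qed
  then show "generated_by_monomials V ?I B \<and> (\<forall>B'. B' \<subset> B \<longrightarrow> \<not> generated_by_monomials V ?I B')"
    using B by blast
  fix A assume A: "generated_by_monomials V ?I A \<and> (\<forall>B'. B' \<subset> A \<longrightarrow> \<not> generated_by_monomials V ?I B')"
  then have eq: "?I = monomial_ideal V A" and AV: "\<forall>a\<in>A. Poly_Mapping.keys a \<subseteq> V" by (simp_all add: gen)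
  have "B \<subseteq> A"
  proof
    fix b assume b: "b \<in> B"
    have "\<exists>a\<in>A. \<exists>c. b = a + c"
      using b by (intro divisor[OF eq assms(1)] bexI[of _ b] exI[of _ 0]) auto
    then obtain a c where a: "a \<in> A" "b = a + c" by blast
    have "mon a \<in> ?I"
      unfolding eq mon_in_monomial_ideal_iff using a(1) AV by (intro conjI bexI[of _ a] exI[of _ 0]) auto
    then obtain b' d where b': "b' \<in> B" "a = b' + d" by (auto simp: mon_in_monomial_ideal_iff)
    then have eq': "b = b' + (d + c)" using a(2) by (simp add: add.assoc)
    then have "b = b'" by (rule antichain[OF b b'(1)])
    \<comment> \<open>Exponents are natural numbers, so a vanishing sum has vanishing
      summands.\<close>
    with eq' have "d + c = 0" by simp
    then have "Poly_Mapping.keys d \<union> Poly_Mapping.keys c = {}" using keys_add_expo[of d c] by simp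
    then have "b = a" using a(2) by simp
    then show "b \<in> A" using a(1) by simp
  qed
  then show "A = B" using A B by blast
qed

lemma edge_finite: "simple_graph V E \<Longrightarrow> e \<in> E \<Longrightarrow> finite e"
  using finite_subset[of e V] by (auto simp: simple_graph_def)

lemma keys_squarefree_expo_edge:
  assumes "simple_graph V E" "b \<in> squarefree_expo ` E"
  shows "Poly_Mapping.keys b \<subseteq> V"
proof -
  obtain e where e: "e \<in> E" "b = squarefree_expo e" using assms(2) by blast
  then have "Poly_Mapping.keys b = e" using edge_finite[OF assms(1)] by (simp add: keys_squarefree_expo)
  then show ?thesis using assms(1) e(1) by (simp add: simple_graph_def)
qed

lemma edge_ideal_eq_monomial_ideal:
  fixes V :: "'v set"
  assumes "simple_graph V E"
  shows "edge_ideal (K :: 'k::field itself) V E = monomial_ideal V (squarefree_expo ` E)"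
proof -
  have pair: "var x * var y = (mon (squarefree_expo {x, y}) :: ('v, 'k) mpoly)" if "{x, y} \<in> E" for x y :: 'v
  proof -
    have "x \<noteq> y" using no_loops[of V E x] assms that by auto
    then show ?thesis by (simp add: squarefree_expo_def var_def mon_def mult_single)
  qed
  have "{var x * var y | x y. {x, y} \<in> E} = (mon ` squarefree_expo ` E :: ('v, 'k) mpoly set)"
  proof (intro equalityI subsetI)
    fix p :: "('v, 'k) mpoly" assume "p \<in> mon ` squarefree_expo ` E"
    then obtain e where e: "e \<in> E" "p = mon (squarefree_expo e)" by blast
    from assms e(1) obtain x y where "e = {x, y}" by (rule edgeE)
    then have "p = var x * var y" "{x, y} \<in> E" using e pair[of x y] by simp_all
    then show "p \<in> {var x * var y | x y. {x, y} \<in> E}" by blast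
  qed (use pair in blast)
  then show ?thesis
    unfolding edge_ideal_def
    using genideal_monomials[OF keys_squarefree_expo_edge[OF assms]] by simp
qed

text \<open>Different k-matchings on the same vertices give the same monomial, so generators are
  indexed by vertex sets.\<close>

definition matching_vertex_sets :: "'v set set \<Rightarrow> nat \<Rightarrow> 'v set set" where
  "matching_vertex_sets E k = {\<Union>M | M. matching E M \<and> card M = k}"

lemma matching_vertex_set:
  assumes "simple_graph V E" "U \<in> matching_vertex_sets E k"
  shows "U \<subseteq> V" "finite U" "card U = 2 * k"
proof -
  obtain M where M: "U = \<Union>M" "matching E M" "card M = k"
    using assms(2) by (auto simp: matching_vertex_sets_def)
  have "M \<subseteq> E" using M(2) by (simp add: matching_def)
  then show "U \<subseteq> V" using assms(1) M(1) by (auto simp: simple_graph_def)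
  then show "finite U" using assms(1) finite_subset by (auto simp: simple_graph_def)
  have "card (\<Union>M) = sum card M"
    using M(2) \<open>M \<subseteq> E\<close> edge_finite[OF assms(1)]
    by (intro card_Union_disjoint) (auto simp: matching_def disjoint_def pairwise_def disjnt_def)
  also have "\<dots> = (\<Sum>e\<in>M. 2)"
    using assms(1) \<open>M \<subseteq> E\<close> by (intro sum.cong) (auto simp: simple_graph_def)
  finally show "card U = 2 * k" using M by simp
qed

text \<open>All edges have two elements, so no edge monomial properly divides another and the edges
  are the minimal generators. Families of k of them with disjoint supports are then the enumerations
  of k-matchings.\<close>

lemma matching_power_edge_ideal:
  fixes V :: "'v set"
  assumes G: "simple_graph V E"
  shows "matching_power V (edge_ideal (K :: 'k::field itself) V E) k =
    monomial_ideal V (squarefree_expo ` matching_vertex_sets E k)"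
proof -
  have fin: "finite e" if "e \<in> E" for e using edge_finite[OF G that] .
  have keys: "Poly_Mapping.keys (squarefree_expo e) = e" if "e \<in> E" for e
    using fin[OF that] by (rule keys_squarefree_expo)
  have gens: "min_monomial_gens V (edge_ideal K V E) = squarefree_expo ` E"
    unfolding edge_ideal_eq_monomial_ideal[OF G]
  proof (rule min_monomial_gens_eq)
    show "Poly_Mapping.keys b \<subseteq> V" if "b \<in> squarefree_expo ` E" for b
      using keys_squarefree_expo_edge[OF G that] .
    fix b b' c assume "b \<in> squarefree_expo ` E" "b' \<in> squarefree_expo ` E" "b = b' + c"
    then obtain e e' where e: "e \<in> E" "e' \<in> E" "b = squarefree_expo e" "b' = squarefree_expo e'"
      "squarefree_expo e = squarefree_expo e' + c" by auto
    have "e' \<subseteq> e" by (rule squarefree_expo_divides[OF fin[OF e(1)] fin[OF e(2)] e(5)])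
    moreover have "card e' = card e" using G e(1,2) by (simp add: simple_graph_def)
    ultimately have "e' = e" by (rule card_subset_eq[OF fin[OF e(1)]])
    then show "b = b'" using e(3,4) by simp
  qed
  have union: "(\<Sum>i<k. squarefree_expo (f i)) = squarefree_expo (\<Union>i<k. f i)"
    if "\<forall>i<k. f i \<in> E" "\<forall>i<k. \<forall>j<k. i \<noteq> j \<longrightarrow> f i \<inter> f j = {}" for f
    unfolding squarefree_expo_def using that fin by (subst sum.UNION_disjoint) simp_all
  have gens_power: "{\<Prod>i<k. mon (u i) | u. (\<forall>i<k. u i \<in> squarefree_expo ` E) \<and>
      (\<forall>i<k. \<forall>j<k. i \<noteq> j \<longrightarrow> Poly_Mapping.keys (u i) \<inter> Poly_Mapping.keys (u j) = {})} =
      (mon ` squarefree_expo ` matching_vertex_sets E k :: ('v, 'k) mpoly set)" (is "?L = ?R")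
  proof (intro equalityI subsetI)
    fix p assume "p \<in> ?L"
    then obtain u where p: "p = (\<Prod>i<k. mon (u i))" and u: "\<forall>i<k. u i \<in> squarefree_expo ` E"
      "\<forall>i<k. \<forall>j<k. i \<noteq> j \<longrightarrow> Poly_Mapping.keys (u i) \<inter> Poly_Mapping.keys (u j) = {}" by blast
    define f where "f i = Poly_Mapping.keys (u i)" for i
    have f: "f i \<in> E" "u i = squarefree_expo (f i)" if "i < k" for i
      using u(1) that keys unfolding f_def by auto
    have disj: "\<forall>i<k. \<forall>j<k. i \<noteq> j \<longrightarrow> f i \<inter> f j = {}" using u(2) by (simp add: f_def)
    \<comment> \<open>Nonempty disjoint sets are distinct, so the k factors give k different
      edges.\<close>
    have "f i \<noteq> {}" if "i < k" for i using f(1)[OF that] G by (auto simp: simple_graph_def)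
    then have inj: "inj_on f {..<k}" using disj by (metis inf.idem inj_onI lessThan_iff)
    have "matching E (f ` {..<k})" unfolding matching_def disjoint_def using f(1) disj by auto
    moreover have "card (f ` {..<k}) = k" using inj by (simp add: card_image)
    ultimately have "(\<Union>i<k. f i) \<in> matching_vertex_sets E k" unfolding matching_vertex_sets_def by blast
    moreover have "p = mon (\<Sum>i<k. squarefree_expo (f i))"
      unfolding p prod_mon using f(2) by simp
    then have "p = mon (squarefree_expo (\<Union>i<k. f i))" using union[of f] f(1) disj by simp
    ultimately show "p \<in> ?R" by blast
  next
    fix p assume "p \<in> ?R"
    then obtain M where M: "p = mon (squarefree_expo (\<Union>M))" "matching E M" "card M = k"
      by (auto simp: matching_vertex_sets_def)
    have "finite M" using M(2) simple_graph_finite_edges[OF G] finite_subset by (auto simp: matching_def)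
    then obtain f where f: "bij_betw f {..<k} M"
      using ex_bij_betw_nat_finite[of M] M(3) by (auto simp: atLeast0LessThan)
    have fE: "\<forall>i<k. f i \<in> E" using f M(2) by (auto simp: bij_betw_def matching_def)
    have disj: "\<forall>i<k. \<forall>j<k. i \<noteq> j \<longrightarrow> f i \<inter> f j = {}"
    proof (intro allI impI)
      fix i j assume ij: "i < k" "j < k" "i \<noteq> j"
      then have "f i \<in> M" "f j \<in> M" using f by (auto simp: bij_betw_def)
      moreover have "f i \<noteq> f j" using inj_onD[OF bij_betw_imp_inj_on[OF f], of i j] ij by auto
      ultimately show "f i \<inter> f j = {}" using M(2) by (simp add: matching_def disjoint_def)
    qed
    have "(\<Union>i<k. f i) = \<Union>M" using f by (simp add: bij_betw_def)
    then have "p = (\<Prod>i<k. mon (squarefree_expo (f i)))"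
      using union[OF fE disj] M(1) by (simp add: prod_mon)
    then show "p \<in> ?L"
      using fE disj keys by (intro CollectI exI[of _ "\<lambda>i. squarefree_expo (f i)"]) auto
  qed
  have keys_power: "Poly_Mapping.keys b \<subseteq> V" if b: "b \<in> squarefree_expo ` matching_vertex_sets E k" for b
  proof -
    obtain U where "U \<in> matching_vertex_sets E k" "b = squarefree_expo U" using b by blast
    then show ?thesis using matching_vertex_set[OF G] by (simp add: keys_squarefree_expo)
  qed
  show ?thesis
    unfolding matching_power_def gens gens_power by (rule genideal_monomials[OF keys_power])
qed

text \<open>Every monomial in the ideal is a multiple of a product of 2k distinct variables, and the
  matching M supplies an element of exactly this degree.\<close>

lemma initial_degree_matching_power:
  fixes V :: "'v set"
  assumes G: "simple_graph V E" and M: "matching E M" "card M = k"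
  shows "initial_degree (matching_power V (edge_ideal (K :: 'k::field itself) V E) k) = 2 * k"
  unfolding initial_degree_def matching_power_edge_ideal[OF G]
proof (rule Least_equality)
  let ?I = "monomial_ideal V (squarefree_expo ` matching_vertex_sets E k) :: ('v, 'k) mpoly set"
  have U: "\<Union>M \<in> matching_vertex_sets E k" using M by (auto simp: matching_vertex_sets_def)
  note fin = matching_vertex_set[OF G U]
  have "mon (squarefree_expo (\<Union>M)) \<in> ?I"
    unfolding mon_in_monomial_ideal_iff keys_squarefree_expo[OF fin(2)]
    using fin(1) U by (intro conjI bexI[of _ "squarefree_expo (\<Union>M)"] exI[of _ 0]) auto
  moreover have "mon (squarefree_expo (\<Union>M)) \<noteq> (0 :: ('v, 'k) mpoly)"
    unfolding mon_def by (metis lookup_single_eq lookup_zero zero_neq_one)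
  moreover have "homogeneous (2 * k) (mon (squarefree_expo (\<Union>M)) :: ('v, 'k) mpoly)"
    using fin by (simp add: homogeneous_def mon_def keys_squarefree_expo lookup_squarefree_expo)
  ultimately show "\<exists>p\<in>?I. p \<noteq> 0 \<and> homogeneous (2 * k) p" by blast
  fix d assume "\<exists>p\<in>?I. p \<noteq> 0 \<and> homogeneous d p"
  then obtain p where p: "p \<in> ?I" "p \<noteq> 0" "homogeneous d p" by blast
  then obtain m where m: "m \<in> Poly_Mapping.keys p" by (metis all_not_in_conv keys_eq_empty)
  then obtain U c where U: "U \<in> matching_vertex_sets E k" "m = squarefree_expo U + c"
    using p(1) by (auto simp: monomial_ideal_def)
  note fin = matching_vertex_set[OF G U(1)]
  have "2 * k = (\<Sum>v\<in>U. Poly_Mapping.lookup (squarefree_expo U) v)"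
    using fin by (simp add: lookup_squarefree_expo)
  also have "\<dots> \<le> (\<Sum>v\<in>U. Poly_Mapping.lookup m v)" by (intro sum_mono) (simp add: U(2) lookup_add)
  also have "\<dots> \<le> (\<Sum>v\<in>Poly_Mapping.keys m. Poly_Mapping.lookup m v)"
    using fin by (intro sum_mono2) (auto simp: U(2) keys_add_expo keys_squarefree_expo)
  also have "\<dots> = d" using p(3) m by (simp add: homogeneous_def)
  finally show "2 * k \<le> d" .
qed

text \<open>Any vertex cover contains a minimal one, and by unmixedness all minimal ones have the
  size of C. So C is a smallest cover and its size is the height of the edge ideal.\<close>

lemma unmixed_height:
  assumes G: "simple_graph V E" and vwc: "very_well_covered (K :: 'k::field itself) V E"
    and C: "minimal_vertex_cover V E C"
  shows "2 * card C = card V"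
proof -
  have finV: "finite V" using G by (simp add: simple_graph_def)
  have keys: "Poly_Mapping.keys (squarefree_expo e) = e" if "e \<in> E" for e
    using edge_finite[OF G that] by (rule keys_squarefree_expo)
  have "ideal_height (poly_ring V) (edge_ideal K V E) = enat (card C)"
  proof (rule ideal_height_monomial_ideal[OF finV _ _ _ _ edge_ideal_eq_monomial_ideal[OF G]])
    show "C \<subseteq> V" using C by (simp add: minimal_vertex_cover_def vertex_cover_def)
    show "Poly_Mapping.keys b \<subseteq> V" if "b \<in> squarefree_expo ` E" for b
      using keys_squarefree_expo_edge[OF G that] .
    show "Poly_Mapping.keys b \<inter> C \<noteq> {}" if "b \<in> squarefree_expo ` E" for b
      using that C keys by (auto simp: minimal_vertex_cover_def vertex_cover_def)
    fix D assume D: "D \<subseteq> V" "\<And>b. b \<in> squarefree_expo ` E \<Longrightarrow> Poly_Mapping.keys b \<inter> D \<noteq> {}"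
    have "e \<inter> D \<noteq> {}" if "e \<in> E" for e using D(2)[of "squarefree_expo e"] keys[OF that] that by simp
    then have "vertex_cover V E D" using D(1) by (simp add: vertex_cover_def)
    then obtain D' where D': "D' \<subseteq> D" "minimal_vertex_cover V E D'"
      using vertex_cover_contains_minimal[OF finV] by metis
    have "card C = card D'" using vwc C D'(2) unfolding very_well_covered_def unmixed_def by blast
    also have "\<dots> \<le> card D" using D'(1) finite_subset[OF D(1) finV] by (rule card_mono[rotated])
    finally show "card C \<le> card D" .
  qed
  then have "2 * enat (card C) = enat (card V)" using vwc by (simp add: very_well_covered_def)
  then show ?thesis by (simp add: numeral_eq_enat)
qed

theorem corollary2p11:
  fixes K :: "'k::field itself"
    and V :: "'v set" and E :: "'v set set"
  assumes "simple_graph V E"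
    and "no_isolated_vertices V E"
    and "very_well_covered K V E"
    and "\<And>k. 1 \<le> k \<Longrightarrow> k \<le> matching_number E \<Longrightarrow>
           cohen_macaulay_ideal V (matching_power V (edge_ideal K V E) k)"
  shows "\<forall>k. 1 \<le> k \<and> k \<le> matching_number E \<longrightarrow>
           real_of_int (normalized_depth V (edge_ideal K V E) k) = real (card V) / 2 - real k"
proof (intro allI impI, elim conjE)
  fix k assume k: "1 \<le> k" "k \<le> matching_number E"
  note G = assms(1)
  have finV: "finite V" and finE: "finite E"
    using G simple_graph_finite_edges[OF G] by (simp_all add: simple_graph_def)
  have "vertex_cover V E V"
    using G by (fastforce simp: vertex_cover_def simple_graph_def Int_absorb2)
  then obtain C where C: "minimal_vertex_cover V E C"
    using finV vertex_cover_contains_minimal by metis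
  define h where "h = card C"
  have h: "2 * h = card V" unfolding h_def by (rule unmixed_height[OF G assms(3) C])
  have "card D = h" if "minimal_vertex_cover V E D" for D
    using assms(3) C that unfolding h_def very_well_covered_def unmixed_def by blast
  with G assms(2) obtain M where M: "matching E M" "card M = h"
    using h by (rule perfect_matching_exists)
  have cover: "vertex_cover V E C" using C by (simp add: minimal_vertex_cover_def)
  then have finC: "finite C" using finV finite_subset by (auto simp: vertex_cover_def)
  have le_h: "card N \<le> h" if "matching E N" for N
    unfolding h_def
  proof (rule matching_card_le[OF that finC])
    show "e \<inter> C \<noteq> {}" if "e \<in> N" for e
      using that \<open>matching E N\<close> cover by (auto simp: matching_def vertex_cover_def)
  qed
  \<comment> \<open>Disjoint edges meet the cover C in distinct vertices. The resulting bound k <= h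
    is needed to cut both D out of C and a k-matching out of M.\<close>
  have "matching_number E \<le> h"
    unfolding matching_number_def
  proof (rule Max.boundedI)
    have "{M. matching E M} \<subseteq> Pow E" by (auto simp: matching_def)
    then show "finite (card ` {M. matching E M})" using finE by (simp add: finite_subset)
  qed (use M le_h in auto)
  then have kh: "k \<le> h" using k(2) by simp
  let ?I = "matching_power V (edge_ideal K V E) k"
  let ?B = "squarefree_expo ` matching_vertex_sets E k"
  obtain N where N: "matching E N" "card N = k"
  proof -
    obtain N where "N \<subseteq> M" "card N = k" using kh M(2) obtain_subset_with_card_n by metis
    moreover have "matching E N" using \<open>N \<subseteq> M\<close> M(1) unfolding matching_def disjoint_def by blast
    ultimately show ?thesis using that by simp
  qed
  have keys: "Poly_Mapping.keys b \<in> matching_vertex_sets E k" "Poly_Mapping.keys b \<subseteq> V" if b: "b \<in> ?B" for b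
  proof -
    obtain U where "U \<in> matching_vertex_sets E k" "b = squarefree_expo U" using b by blast
    then show "Poly_Mapping.keys b \<in> matching_vertex_sets E k" "Poly_Mapping.keys b \<subseteq> V"
      using matching_vertex_set[OF G] by (simp_all add: keys_squarefree_expo)
  qed
  obtain D where D: "D \<subseteq> C" "meets_matchings E k D" "card D + k = h + 1"
    using meets_matchings_exists[OF finV cover k(1)] kh unfolding h_def by metis
  have DV: "D \<subseteq> V" using D(1) cover by (auto simp: vertex_cover_def)
  have meets_D: "Poly_Mapping.keys b \<inter> D \<noteq> {}" if "b \<in> ?B" for b
    using keys(1)[OF that] D(2) unfolding matching_vertex_sets_def meets_matchings_def by auto
  have height: "prime_height (poly_ring V Quot ?I) ((+>\<^bsub>poly_ring V\<^esub>) ?I ` variable_prime V V)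
      = enat (card V - card D)"
  proof (rule prime_height_quotient_monomial_ideal[OF finV keys(2) DV _ _ matching_power_edge_ideal[OF G]])
    show "Poly_Mapping.keys b \<inter> D \<noteq> {}" if "b \<in> ?B" for b using meets_D[OF that] .
    fix D' assume D': "D' \<subseteq> V" "\<And>b. b \<in> ?B \<Longrightarrow> Poly_Mapping.keys b \<inter> D' \<noteq> {}"
    have "U \<inter> D' \<noteq> {}" if "U \<in> matching_vertex_sets E k" for U
      using D'(2)[of "squarefree_expo U"] matching_vertex_set(2)[OF G that] that
      by (simp add: keys_squarefree_expo)
    then have "meets_matchings E k D'" by (auto simp: meets_matchings_def matching_vertex_sets_def)
    \<comment> \<open>The perfect matching enters here: it shows that no set meeting all k-matchings
      is smaller than D.\<close>
    then have "card M + 1 \<le> card D' + k"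
      using M(1) finE finite_subset[OF D'(1) finV] k(1)
      by (intro meets_matchings_card_ge) (auto simp: matching_def finite_subset)
    then show "card D \<le> card D'" using D(3) M(2) by simp
  qed
  have CM: "cohen_macaulay_ring (poly_ring V Quot ?I)" "ideal ?I (poly_ring V)"
    using assms(4)[OF k] by (simp_all add: cohen_macaulay_ideal_def)
  have "?I \<subseteq> variable_prime V D"
    unfolding matching_power_edge_ideal[OF G] by (rule monomial_ideal_subset_variable_prime[OF meets_D])
  then have "?I \<subseteq> variable_prime V V" using variable_prime_mono[OF DV] by blast
  \<comment> \<open>The Cohen-Macaulay property equates depth and height at maximal ideals, and this
    is the one at which the depth of the graded ring is taken.\<close>
  then have "maximalideal ((+>\<^bsub>poly_ring V\<^esub>) ?I ` variable_prime V V) (poly_ring V Quot ?I)"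
    by (intro cring.quotient_image_maximalideal cring_poly_ring CM graded_maximal_ideal_maximalideal finV)
  then have "quotient_depth V ?I = enat (card V - card D)"
    using CM(1) height unfolding cohen_macaulay_ring_def quotient_depth_def graded_maximal_ideal_eq by simp
  then have "normalized_depth V (edge_ideal K V E) k = int (card V - card D) - (int (2 * k) - 1)"
    unfolding normalized_depth_def initial_degree_matching_power[OF G N] by simp
  \<comment> \<open>With card D = h - k + 1 and card V = 2h the depth is h + k - 1, from which 2k -
    1 is subtracted.\<close>
  also have "\<dots> = int h - int k" using D(3) h kh k(1) by linarith
  finally show "real_of_int (normalized_depth V (edge_ideal K V E) k) = real (card V) / 2 - real k"
    using h by (simp flip: h)
qed

end
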